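(* For any staged tree $\mathcal{T}$, the localised map $$\varphi_{\mathbf{p}}:\bigl(\mathbb{R}[p_1,\ldots,p_n]/I_{\mathcal{T}}\bigr)_{\mathbf{p}}\to\bigl(\mathbb{R}[\Theta]/\langle\theta-1\rangle\bigr)_{\varphi(\mathbf{p})}$$ is an isomorphism of $\mathbb{R}$-algebras. Hence $(\ker\varphi)_{\mathbf{p}}=(I_{\mathcal{T}})_{\mathbf{p}}$.
   Context: A probability tree is a directed rooted tree $\mathcal{T}=(V,E)$ in which every vertex has either no or at least two outgoing edges, together with a label $\theta(e)\in(0,1)$ for every edge $e\in E$, such that the labels of all edges coming out of the same vertex sum to one. $E(v)\subseteq E$ denotes the set of edges going out of the vertex $v$. A staged tree is a probability tree together with an equivalence relation $\sim$ on the vertex set such that two vertices $v,w$ are in the same stage, $v\sim w$, if and only if their outgoing edges have the same attached labels, that is, the vectors $(\theta(e)\mid e\in E(v))$ and $(\theta(e)\mid e\in E(w))$ are equal, possibly up to a permutation of the components. Let $\lambda_1,\ldots,\lambda_n$ be the root-to-leaf paths of $\mathcal{T}$ and $E(\lambda_i)\subseteq E$ the edge set of $\lambda_i$. $\mathbb{R}[p_1,\ldots,p_n]$ is the polynomial ring whose indeterminates are given by the atomic probabilities (one for each root-to-leaf path), and $\mathbb{R}[\Theta]=\mathbb{R}[\theta(e)\mid e\in E]$ is the polynomial ring whose indeterminates are given by the edge labels of $\mathcal{T}$ (labels identified by the stages being the same indeterminate). The ring map $\varphi$ is $$\varphi:\mathbb{R}[p_1,\ldots,p_n]\to\mathbb{R}[\Theta]/\langle\theta-1\rangle,\quad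 p_i\mapsto\prod_{e\in E(\lambda_i)}\theta(e)\quad(i=1,\ldots,n),$$ where $\langle\theta-1\rangle=\langle\sum_{e\in E(v)}\theta(e)-1\mid v\in V\text{ with }E(v)\neq\emptyset\rangle$. The polynomial $p_1+\cdots+p_n-1$ is in the kernel of $\varphi$; following common practice in algebraic statistics, $\ker\varphi$ can always be considered as a homogeneous ideal in projective space. For $v\in V$ let $[v]\subseteq\{1,\ldots,n\}$ be the set of indices $i$ such that $\lambda_i$ passes through $v$, and let $p_{[v]}=\sum_{i\in[v]}p_i$. The ideal of model invariants is $$I_{\mathcal{T}}=\bigl\langle p_{[v]}p_{[w']}-p_{[v']}p_{[w]}\;\big|\;\text{for all }v\sim w\text{ and all }(v,v'),(w,w')\in E\text{ with the same label}\bigr\rangle\subseteq\mathbb{R}[p_1,\ldots,p_n];$$ it is contained in $\ker\varphi$. Every edge label is a conditional probability $\theta(v,v')=p_{[v']}/p_{[v]}$, and $\mathbf{p}\in\mathbb{R}[p_1,\ldots,p_n]$ denotes the product of all the denominators which appear in the identified conditional probabilities $p_{[v']}/p_{[v]}$ in the staged tree. The subscripts $\mathbf{p}$ and $\varphi(\mathbf{p})$ denote localisation at these elements, and $\varphi_{\mathbf{p}}$ is the map induced by $\varphi$.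
   Formalization: As written, p_1+...+p_n-1 maps to 0, so φ_p is not injective; proved instead for the degree-zero part of the source with ker φ replaced by the ideal of its homogeneous elements, and also with p_1+...+p_n-1 added to I_T and the full ker φ. *)

theory Defs
  imports
    "HOL-Algebra.QuotRing"
    "HOL-Library.Poly_Mapping"
    "Graph_Theory.Arc_Walk"
begin

section \<open>Polynomial rings over the reals\<close>

text \<open>A monomial is a finitely supported exponent function, a polynomial a finitely supported
  coefficient function on monomials. Indeterminates are arbitrary elements of \<open>X\<close>.\<close>

type_synonym 'x rpoly = "('x \<Rightarrow>\<^sub>0 nat) \<Rightarrow>\<^sub>0 real"

definition mpoly_ring :: "'x set \<Rightarrow> 'x rpoly ring" where
  "mpoly_ring X = \<lparr>carrier = {f. \<forall>m\<in>Poly_Mapping.keys f. Poly_Mapping.keys m \<subseteq> X},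
     mult = (*), one = 1, zero = 0, add = (+)\<rparr>"

definition mconst :: "real \<Rightarrow> 'x rpoly" where
  "mconst c = Poly_Mapping.single 0 c"

definition mvar :: "'x \<Rightarrow> 'x rpoly" where
  "mvar x = Poly_Mapping.single (Poly_Mapping.single x 1) 1"

definition msubst :: "('x \<Rightarrow> 'y rpoly) \<Rightarrow> 'x rpoly \<Rightarrow> 'y rpoly" where
  "msubst \<sigma> f = (\<Sum>m\<in>Poly_Mapping.keys f.
     mconst (Poly_Mapping.lookup f m) * (\<Prod>x\<in>Poly_Mapping.keys m. \<sigma> x ^ Poly_Mapping.lookup m x))"

definition homogeneous :: "nat \<Rightarrow> 'x rpoly \<Rightarrow> bool" where
  "homogeneous d f \<longleftrightarrow> (\<forall>m\<in>Poly_Mapping.keys f. (\<Sum>x\<in>Poly_Mapping.keys m. Poly_Mapping.lookup m x) = d)"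


section \<open>Localisation of a commutative ring at (the powers of) an element\<close>

definition powers :: "('a, 'm) ring_scheme \<Rightarrow> 'a \<Rightarrow> 'a set" where
  "powers R x = {x [^]\<^bsub>R\<^esub> n | n :: nat. True}"

definition loc_rel :: "('a, 'm) ring_scheme \<Rightarrow> 'a \<Rightarrow> (('a \<times> 'a) \<times> ('a \<times> 'a)) set" where
  "loc_rel R x = {((a, s), (b, t)). a \<in> carrier R \<and> b \<in> carrier R \<and>
     s \<in> powers R x \<and> t \<in> powers R x \<and>
     (\<exists>u\<in>powers R x. u \<otimes>\<^bsub>R\<^esub> (t \<otimes>\<^bsub>R\<^esub> a) = u \<otimes>\<^bsub>R\<^esub> (s \<otimes>\<^bsub>R\<^esub> b))}"

definition loc_frac :: "('a, 'm) ring_scheme \<Rightarrow> 'a \<Rightarrow> 'a \<Rightarrow> 'a \<Rightarrow> ('a \<times> 'a) set" where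
  "loc_frac R x a s = loc_rel R x `` {(a, s)}"

text \<open>The operations are taken over all representatives; the unions are unions of equal classes.\<close>

definition localise :: "('a, 'm) ring_scheme \<Rightarrow> 'a \<Rightarrow> ('a \<times> 'a) set ring" where
  "localise R x = \<lparr>carrier = (carrier R \<times> powers R x) // loc_rel R x,
     mult = (\<lambda>X Y. \<Union>(a, s)\<in>X. \<Union>(b, t)\<in>Y. loc_frac R x (a \<otimes>\<^bsub>R\<^esub> b) (s \<otimes>\<^bsub>R\<^esub> t)),
     one = loc_frac R x \<one>\<^bsub>R\<^esub> \<one>\<^bsub>R\<^esub>,
     zero = loc_frac R x \<zero>\<^bsub>R\<^esub> \<one>\<^bsub>R\<^esub>,
     add = (\<lambda>X Y. \<Union>(a, s)\<in>X. \<Union>(b, t)\<in>Y.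
       loc_frac R x (t \<otimes>\<^bsub>R\<^esub> a \<oplus>\<^bsub>R\<^esub> s \<otimes>\<^bsub>R\<^esub> b) (s \<otimes>\<^bsub>R\<^esub> t))\<rparr>"

definition loc_ideal :: "('a, 'm) ring_scheme \<Rightarrow> 'a \<Rightarrow> 'a set \<Rightarrow> ('a \<times> 'a) set set" where
  "loc_ideal R x I = {loc_frac R x a s | a s. a \<in> I \<and> s \<in> powers R x}"

text \<open>The maps induced by \<open>h\<close> on a quotient and on a localisation. The argument of \<open>the_elem\<close>
  is a singleton exactly when the induced map is well defined on the given class.\<close>

definition quot_map :: "('a \<Rightarrow> 'b) \<Rightarrow> 'a set \<Rightarrow> 'b" where
  "quot_map h C = the_elem (h ` C)"

definition loc_map ::
    "('b, 'm) ring_scheme \<Rightarrow> 'b \<Rightarrow> ('a \<Rightarrow> 'b) \<Rightarrow> ('a \<times> 'a) set \<Rightarrow> ('b \<times> 'b) set" where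
  "loc_map R y h X = the_elem ((\<lambda>(a, s). loc_frac R y (h a) (h s)) ` X)"

text \<open>The \<open>\<real>\<close>-algebra structure of a ring is given by its structure map from the reals.\<close>

definition real_alg_hom ::
    "('a, 'm) ring_scheme \<Rightarrow> (real \<Rightarrow> 'a) \<Rightarrow> ('b, 'n) ring_scheme \<Rightarrow> (real \<Rightarrow> 'b) \<Rightarrow> ('a \<Rightarrow> 'b) set" where
  "real_alg_hom R \<alpha> S \<beta> = {h \<in> ring_hom R S. \<forall>c. h (\<alpha> c) = \<beta> c}"

definition real_alg_iso ::
    "('a, 'm) ring_scheme \<Rightarrow> (real \<Rightarrow> 'a) \<Rightarrow> ('b, 'n) ring_scheme \<Rightarrow> (real \<Rightarrow> 'b) \<Rightarrow> ('a \<Rightarrow> 'b) set" where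
  "real_alg_iso R \<alpha> S \<beta> = {h \<in> ring_iso R S. \<forall>c. h (\<alpha> c) = \<beta> c}"


section \<open>Staged trees\<close>

text \<open>\<open>out_arcs T v\<close> is the set $E(v)$; edges point away from the root.\<close>

locale probability_tree = fin_digraph T
  for T :: "('v, 'e) pre_digraph" and r :: 'v and \<theta> :: "'e \<Rightarrow> real" +
  assumes root_in_verts: "r \<in> verts T"
    and unique_awalk: "v \<in> verts T \<Longrightarrow> \<exists>!es. awalk r es v"
    and branching: "v \<in> verts T \<Longrightarrow> out_arcs T v = {} \<or> 2 \<le> card (out_arcs T v)"
    and label_pos: "e \<in> arcs T \<Longrightarrow> 0 < \<theta> e"
    and label_less_1: "e \<in> arcs T \<Longrightarrow> \<theta> e < 1"
    and labels_sum: "v \<in> verts T \<Longrightarrow> out_arcs T v \<noteq> {} \<Longrightarrow> (\<Sum>e\<in>out_arcs T v. \<theta> e) = 1"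

locale staged_tree = probability_tree T r \<theta>
  for T :: "('v, 'e) pre_digraph" and r :: 'v and \<theta> :: "'e \<Rightarrow> real" +
  fixes stage :: "'v rel"
  assumes equiv_stage: "equiv (verts T) stage"
    and stage_iff: "v \<in> verts T \<Longrightarrow> w \<in> verts T \<Longrightarrow> (v, w) \<in> stage \<longleftrightarrow>
      (\<exists>\<pi>. bij_betw \<pi> (out_arcs T v) (out_arcs T w) \<and> (\<forall>e\<in>out_arcs T v. \<theta> (\<pi> e) = \<theta> e))"

definition paths :: "('v, 'e) pre_digraph \<Rightarrow> 'v \<Rightarrow> 'e list set" where
  "paths T r = {es. \<exists>l\<in>verts T. out_arcs T l = {} \<and> pre_digraph.awalk T r es l}"

definition paths_through :: "('v, 'e) pre_digraph \<Rightarrow> 'v \<Rightarrow> 'v \<Rightarrow> 'e list set" where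
  "paths_through T r v = {es \<in> paths T r. v \<in> set (pre_digraph.awalk_verts T r es)}"

text \<open>The indeterminate attached to an edge is the class of all edges which have the same label
  and start in the same stage. Equal labels in different stages are \<^emph>\<open>not\<close> identified.\<close>

definition edge_class :: "('v, 'e) pre_digraph \<Rightarrow> ('e \<Rightarrow> real) \<Rightarrow> 'v rel \<Rightarrow> 'e \<Rightarrow> 'e set" where
  "edge_class T \<theta> stage e = {f \<in> arcs T. (tail T e, tail T f) \<in> stage \<and> \<theta> f = \<theta> e}"

definition prob_ring :: "('v, 'e) pre_digraph \<Rightarrow> 'v \<Rightarrow> 'e list rpoly ring" where
  "prob_ring T r = mpoly_ring (paths T r)"

definition label_ring ::
    "('v, 'e) pre_digraph \<Rightarrow> ('e \<Rightarrow> real) \<Rightarrow> 'v rel \<Rightarrow> 'e set rpoly ring" where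
  "label_ring T \<theta> stage = mpoly_ring (edge_class T \<theta> stage ` arcs T)"

definition sum_to_one_ideal ::
    "('v, 'e) pre_digraph \<Rightarrow> ('e \<Rightarrow> real) \<Rightarrow> 'v rel \<Rightarrow> 'e set rpoly set" where
  "sum_to_one_ideal T \<theta> stage = Idl\<^bsub>label_ring T \<theta> stage\<^esub>
     {(\<Sum>e\<in>out_arcs T v. mvar (edge_class T \<theta> stage e)) - 1 | v. v \<in> verts T \<and> out_arcs T v \<noteq> {}}"

definition label_quot ::
    "('v, 'e) pre_digraph \<Rightarrow> ('e \<Rightarrow> real) \<Rightarrow> 'v rel \<Rightarrow> 'e set rpoly set ring" where
  "label_quot T \<theta> stage = label_ring T \<theta> stage Quot sum_to_one_ideal T \<theta> stage"

definition model_map ::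
    "('v, 'e) pre_digraph \<Rightarrow> ('e \<Rightarrow> real) \<Rightarrow> 'v rel \<Rightarrow> 'e list rpoly \<Rightarrow> 'e set rpoly set" where
  "model_map T \<theta> stage f = sum_to_one_ideal T \<theta> stage +>\<^bsub>label_ring T \<theta> stage\<^esub>
     msubst (\<lambda>es. \<Prod>e\<in>set es. mvar (edge_class T \<theta> stage e)) f"

definition p_vertex :: "('v, 'e) pre_digraph \<Rightarrow> 'v \<Rightarrow> 'v \<Rightarrow> 'e list rpoly" where
  "p_vertex T r v = (\<Sum>es\<in>paths_through T r v. mvar es)"

definition invariant_ideal ::
    "('v, 'e) pre_digraph \<Rightarrow> 'v \<Rightarrow> ('e \<Rightarrow> real) \<Rightarrow> 'v rel \<Rightarrow> 'e list rpoly set" where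
  "invariant_ideal T r \<theta> stage = Idl\<^bsub>prob_ring T r\<^esub>
     {p_vertex T r (tail T e) * p_vertex T r (head T f)
        - p_vertex T r (head T e) * p_vertex T r (tail T f) | e f.
        e \<in> arcs T \<and> f \<in> arcs T \<and> (tail T e, tail T f) \<in> stage \<and> \<theta> e = \<theta> f}"

text \<open>The denominators of the conditional probabilities $p_{[v']}/p_{[v]}$ are the $p_{[v]}$
  for the vertices $v$ with an outgoing edge.\<close>

definition denominators :: "('v, 'e) pre_digraph \<Rightarrow> 'v \<Rightarrow> 'e list rpoly" where
  "denominators T r = (\<Prod>v | v \<in> verts T \<and> out_arcs T v \<noteq> {}. p_vertex T r v)"


section \<open>The localised map\<close>

text \<open>$\ker\varphi$ contains the inhomogeneous polynomial $p_1+\dots+p_n-1$, whereas the ideal of model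
  invariants is homogeneous. The two are compared either in affine space, adding
  $p_1+\dots+p_n-1$ to the invariants, or in projective space, replacing $\ker\varphi$ by the ideal
  generated by its homogeneous elements and rings of fractions by their degree-zero parts.\<close>

definition affine_invariant_ideal ::
    "('v, 'e) pre_digraph \<Rightarrow> 'v \<Rightarrow> ('e \<Rightarrow> real) \<Rightarrow> 'v rel \<Rightarrow> 'e list rpoly set" where
  "affine_invariant_ideal T r \<theta> stage = Idl\<^bsub>prob_ring T r\<^esub>
     (invariant_ideal T r \<theta> stage \<union> {(\<Sum>es\<in>paths T r. mvar es) - 1})"

definition model_ker ::
    "('v, 'e) pre_digraph \<Rightarrow> 'v \<Rightarrow> ('e \<Rightarrow> real) \<Rightarrow> 'v rel \<Rightarrow> 'e list rpoly set" where
  "model_ker T r \<theta> stage = a_kernel (prob_ring T r) (label_quot T \<theta> stage) (model_map T \<theta> stage)"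

definition homogeneous_ker ::
    "('v, 'e) pre_digraph \<Rightarrow> 'v \<Rightarrow> ('e \<Rightarrow> real) \<Rightarrow> 'v rel \<Rightarrow> 'e list rpoly set" where
  "homogeneous_ker T r \<theta> stage =
     Idl\<^bsub>prob_ring T r\<^esub> {f \<in> model_ker T r \<theta> stage. \<exists>d. homogeneous d f}"

text \<open>For an ideal \<open>J\<close>: the \<open>\<real>\<close>-algebra $(\mathbb{R}[p_1,\dots,p_n]/J)_{\mathbf{p}}$.\<close>

definition loc_prob_quot ::
    "('v, 'e) pre_digraph \<Rightarrow> 'v \<Rightarrow> 'e list rpoly set \<Rightarrow>
      ('e list rpoly set \<times> 'e list rpoly set) set ring" where
  "loc_prob_quot T r J =
     localise (prob_ring T r Quot J) (J +>\<^bsub>prob_ring T r\<^esub> denominators T r)"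

definition prob_frac ::
    "('v, 'e) pre_digraph \<Rightarrow> 'v \<Rightarrow> 'e list rpoly set \<Rightarrow> 'e list rpoly \<Rightarrow> nat \<Rightarrow>
      ('e list rpoly set \<times> 'e list rpoly set) set" where
  "prob_frac T r J f k =
     loc_frac (prob_ring T r Quot J) (J +>\<^bsub>prob_ring T r\<^esub> denominators T r)
       (J +>\<^bsub>prob_ring T r\<^esub> f)
       ((J +>\<^bsub>prob_ring T r\<^esub> denominators T r) [^]\<^bsub>prob_ring T r Quot J\<^esub> k)"

definition prob_scalar ::
    "('v, 'e) pre_digraph \<Rightarrow> 'v \<Rightarrow> 'e list rpoly set \<Rightarrow> real \<Rightarrow>
      ('e list rpoly set \<times> 'e list rpoly set) set" where
  "prob_scalar T r J c = prob_frac T r J (mconst c) 0"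

text \<open>The degree-zero part is meaningful for a homogeneous ideal \<open>J\<close>.\<close>

definition loc_prob_quot_degree0 ::
    "('v, 'e) pre_digraph \<Rightarrow> 'v \<Rightarrow> 'e list rpoly set \<Rightarrow>
      ('e list rpoly set \<times> 'e list rpoly set) set ring" where
  "loc_prob_quot_degree0 T r J = (loc_prob_quot T r J)
     \<lparr>carrier := {prob_frac T r J f k | f k d. f \<in> carrier (prob_ring T r) \<and>
        homogeneous d f \<and> homogeneous d (denominators T r ^ k)}\<rparr>"

definition loc_label_quot ::
    "('v, 'e) pre_digraph \<Rightarrow> 'v \<Rightarrow> ('e \<Rightarrow> real) \<Rightarrow> 'v rel \<Rightarrow>
      ('e set rpoly set \<times> 'e set rpoly set) set ring" where
  "loc_label_quot T r \<theta> stage =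
     localise (label_quot T \<theta> stage) (model_map T \<theta> stage (denominators T r))"

definition label_frac ::
    "('v, 'e) pre_digraph \<Rightarrow> 'v \<Rightarrow> ('e \<Rightarrow> real) \<Rightarrow> 'v rel \<Rightarrow> 'e set rpoly set \<Rightarrow> nat \<Rightarrow>
      ('e set rpoly set \<times> 'e set rpoly set) set" where
  "label_frac T r \<theta> stage g k =
     loc_frac (label_quot T \<theta> stage) (model_map T \<theta> stage (denominators T r)) g
       (model_map T \<theta> stage (denominators T r) [^]\<^bsub>label_quot T \<theta> stage\<^esub> k)"

definition label_scalar ::
    "('v, 'e) pre_digraph \<Rightarrow> 'v \<Rightarrow> ('e \<Rightarrow> real) \<Rightarrow> 'v rel \<Rightarrow> real \<Rightarrow>
      ('e set rpoly set \<times> 'e set rpoly set) set" where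
  "label_scalar T r \<theta> stage c = label_frac T r \<theta> stage
     (sum_to_one_ideal T \<theta> stage +>\<^bsub>label_ring T \<theta> stage\<^esub> mconst c) 0"

text \<open>The map induced by \<open>model_map\<close> on $(\mathbb{R}[p_1,\dots,p_n]/J)_{\mathbf{p}}$; it does not mention
  \<open>J\<close>, since cosets and fractions are represented as sets.\<close>

definition model_map_loc ::
    "('v, 'e) pre_digraph \<Rightarrow> 'v \<Rightarrow> ('e \<Rightarrow> real) \<Rightarrow> 'v rel \<Rightarrow>
      ('e list rpoly set \<times> 'e list rpoly set) set \<Rightarrow> ('e set rpoly set \<times> 'e set rpoly set) set" where
  "model_map_loc T r \<theta> stage = loc_map (label_quot T \<theta> stage) (model_map T \<theta> stage (denominators T r))
     (quot_map (model_map T \<theta> stage))"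

end

theory Submission
  imports Defs "HOL-Computational_Algebra.Polynomial"
begin

text \<open>Write \<open>x\<^sub>e\<close> for the indeterminate of an edge, \<open>p\<^sub>v\<close> for the probability of passing through
  \<open>v\<close>, \<open>\<phi>\<close> for the model map and \<open>d\<close> for the product of the \<open>p\<^sub>v\<close> over all inner vertices.

  Since the labels around each inner vertex sum to one, summing leaf probabilities from the leaves
  upwards gives \<open>\<phi>(p\<^sub>v) = \<Prod> x\<^sub>e\<close> over the edges from the root to \<open>v\<close> (\<open>label_subst_p_vertex\<close>).
  Hence \<open>\<phi>(p\<^sub>w) = x\<^sub>e \<phi>(p\<^sub>v)\<close> for every edge \<open>e = (v, w)\<close>. In particular all invariants lie in the
  kernel, and \<open>x\<^sub>e\<close> is the image of the fraction \<open>p\<^sub>w / p\<^sub>v\<close> once \<open>d\<close> is inverted. This also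
  shows surjectivity, even from fractions of degree zero: \<open>p\<^sub>w / p\<^sub>v\<close> has degree zero, and a
  denominator \<open>\<phi>(d)\<close> can be rebalanced with powers of \<open>p\<^sub>r\<close>, \<open>r\<close> the root, because \<open>\<phi>(p\<^sub>r) = 1\<close>.

  Conversely, let \<open>I\<close> be an ideal containing the invariants. Modulo \<open>I\<close> and with \<open>d\<close>
  invertible, \<open>x\<^sub>e \<mapsto> p\<^sub>w / p\<^sub>v\<close> is independent of the edge chosen in the class, because this is
  what the invariants say, and it respects the sum-to-one relations, because \<open>p\<^sub>v\<close> is the sum of
  the \<open>p\<^sub>w\<close> over the children \<open>w\<close>. Along a root-to-leaf path the quotients telescope to
  \<open>p\<^sub>i / p\<^sub>r\<close>. So this map \<open>\<psi>\<close> satisfies \<open>\<psi>(\<phi>(f)) = f / p\<^sub>r\<^sup>n\<close> for \<open>f\<close> homogeneous of degree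
  \<open>n\<close>, and \<open>\<psi>(\<phi>(f)) = f\<close> for every \<open>f\<close> if \<open>p\<^sub>r - 1 \<in> I\<close>. In both cases \<open>\<phi>(f) = 0\<close> forces
  \<open>d\<^sup>m f \<in> I\<close> for some \<open>m\<close>, which gives injectivity and the two equalities of localised ideals.

  The fractions \<open>p\<^sub>w / p\<^sub>v\<close> are realised by the trick of Rabinowitsch: \<open>\<psi>\<close> is a substitution into
  polynomials in one more variable \<open>t\<close> over the ring of the \<open>p\<^sub>i\<close>, with \<open>t\<close> in the role of
  \<open>1 / d\<close>, and everything is read modulo the ideal \<open>inv_ideal\<close>, which contains \<open>I\<close> and
  \<open>t d - 1\<close>. Thus \<open>\<psi>\<close> is an ordinary polynomial substitution into a type of class
  \<open>comm_ring_1\<close>.\<close>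

section \<open>Evaluation of polynomials in a commutative ring\<close>

definition mono_eval :: "('x \<Rightarrow> 'r::comm_ring_1) \<Rightarrow> ('x \<Rightarrow>\<^sub>0 nat) \<Rightarrow> 'r" where
  "mono_eval \<sigma> m = (\<Prod>x\<in>Poly_Mapping.keys m. \<sigma> x ^ Poly_Mapping.lookup m x)"

text \<open>This generalises \<open>msubst\<close> to an arbitrary target: for the inverse of the model map the target
  is a polynomial ring over a polynomial ring, not a polynomial ring over the reals.\<close>
definition poly_eval :: "(real \<Rightarrow> 'r::comm_ring_1) \<Rightarrow> ('x \<Rightarrow> 'r) \<Rightarrow> 'x rpoly \<Rightarrow> 'r" where
  "poly_eval c \<sigma> f = (\<Sum>m\<in>Poly_Mapping.keys f. c (Poly_Mapping.lookup f m) * mono_eval \<sigma> m)"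

lemma msubst_eq_poly_eval: "msubst \<sigma> = poly_eval mconst \<sigma>"
  by (simp add: fun_eq_iff msubst_def poly_eval_def mono_eval_def)

lemma mono_eval_superset:
  assumes "finite A" "Poly_Mapping.keys m \<subseteq> A"
  shows "mono_eval \<sigma> m = (\<Prod>x\<in>A. \<sigma> x ^ Poly_Mapping.lookup m x)"
  unfolding mono_eval_def
  by (rule prod.mono_neutral_left) (use assms in \<open>auto simp: in_keys_iff\<close>)

lemma mono_eval_add: "mono_eval \<sigma> (m + n) = mono_eval \<sigma> m * mono_eval \<sigma> n"
proof -
  let ?A = "Poly_Mapping.keys m \<union> Poly_Mapping.keys n"
  have "mono_eval \<sigma> (m + n) = (\<Prod>x\<in>?A. \<sigma> x ^ Poly_Mapping.lookup (m + n) x)"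
    by (rule mono_eval_superset) (auto dest: subsetD[OF keys_add])
  also have "\<dots> = (\<Prod>x\<in>?A. \<sigma> x ^ Poly_Mapping.lookup m x) * (\<Prod>x\<in>?A. \<sigma> x ^ Poly_Mapping.lookup n x)"
    by (simp add: lookup_add power_add prod.distrib)
  also have "\<dots> = mono_eval \<sigma> m * mono_eval \<sigma> n"
    by (simp add: mono_eval_superset[of ?A])
  finally show ?thesis .
qed

lemma mono_eval_0 [simp]: "mono_eval \<sigma> 0 = 1"
  by (simp add: mono_eval_def)

lemma rpoly_sum_monomials:
  "f = (\<Sum>m\<in>Poly_Mapping.keys f. Poly_Mapping.single m (Poly_Mapping.lookup f m))"
  by (rule poly_mapping_eqI) (auto simp: lookup_sum lookup_single when_def in_keys_iff)

lemma mconst_ring_hom [simp]: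
  "mconst 0 = 0" "mconst 1 = 1" "mconst (a + b) = mconst a + mconst b"
  "mconst (a * b) = mconst a * mconst b" "mconst (- a) = - mconst a"
  by (simp_all add: mconst_def single_add mult_single single_uminus)

text \<open>Every term is built from constants and variables by multiplication, which is what reduces
  \<open>mpoly_induct\<close> to closure properties.\<close>
lemma single_eq_mono_eval: "Poly_Mapping.single m a = mconst a * mono_eval mvar m"
proof -
  have var: "mvar x ^ k = Poly_Mapping.single (Poly_Mapping.single x k) (1::real)" for x :: 'a and k
    by (induction k) (auto simp: mvar_def mult_single single_add[symmetric])
  have prod: "(\<Prod>x\<in>A. Poly_Mapping.single (g x) (1::real)) = Poly_Mapping.single (\<Sum>x\<in>A. g x) 1"
    if "finite A" for A and g :: "'a \<Rightarrow> 'a \<Rightarrow>\<^sub>0 nat"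
    using that by (induction A) (auto simp: mult_single)
  have "m = (\<Sum>x\<in>Poly_Mapping.keys m. Poly_Mapping.single x (Poly_Mapping.lookup m x))"
    by (rule poly_mapping_eqI) (auto simp: lookup_sum lookup_single when_def in_keys_iff)
  then have "mono_eval mvar m = Poly_Mapping.single m 1"
    by (simp add: mono_eval_def var prod)
  then show ?thesis
    by (simp add: mconst_def mult_single)
qed

locale scalar_hom =
  fixes c :: "real \<Rightarrow> 'r::comm_ring_1"
  assumes c_add: "c (a + b) = c a + c b"
    and c_mult: "c (a * b) = c a * c b"
    and c_1 [simp]: "c 1 = 1"
begin

lemma c_0 [simp]: "c 0 = 0"
  using c_add[of 0 0] by simp

lemma poly_eval_superset:
  assumes "finite A" "Poly_Mapping.keys f \<subseteq> A"
  shows "poly_eval c \<sigma> f = (\<Sum>m\<in>A. c (Poly_Mapping.lookup f m) * mono_eval \<sigma> m)"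
  unfolding poly_eval_def
  by (rule sum.mono_neutral_left) (use assms in \<open>auto simp: in_keys_iff\<close>)

lemma poly_eval_add: "poly_eval c \<sigma> (f + g) = poly_eval c \<sigma> f + poly_eval c \<sigma> g"
proof -
  let ?A = "Poly_Mapping.keys f \<union> Poly_Mapping.keys g"
  have "poly_eval c \<sigma> (f + g) = (\<Sum>m\<in>?A. c (Poly_Mapping.lookup (f + g) m) * mono_eval \<sigma> m)"
    by (rule poly_eval_superset) (auto dest: subsetD[OF keys_add])
  then show ?thesis
    by (simp add: lookup_add c_add distrib_right sum.distrib poly_eval_superset[of ?A])
qed

lemma poly_eval_0 [simp]: "poly_eval c \<sigma> 0 = 0"
  by (simp add: poly_eval_def)

lemma poly_eval_sum: "poly_eval c \<sigma> (\<Sum>i\<in>A. f i) = (\<Sum>i\<in>A. poly_eval c \<sigma> (f i))"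
  by (induction A rule: infinite_finite_induct) (auto simp: poly_eval_add)

lemma poly_eval_single: "poly_eval c \<sigma> (Poly_Mapping.single m a) = c a * mono_eval \<sigma> m"
  by (simp add: poly_eval_def)

lemma poly_eval_mconst [simp]: "poly_eval c \<sigma> (mconst a) = c a"
  by (simp add: mconst_def poly_eval_single)

lemma poly_eval_1 [simp]: "poly_eval c \<sigma> 1 = 1"
  using poly_eval_mconst[of \<sigma> 1] by simp

lemma poly_eval_mvar [simp]: "poly_eval c \<sigma> (mvar x) = \<sigma> x"
  by (simp add: mvar_def poly_eval_single) (simp add: mono_eval_def)

text \<open>Both factors are expanded into terms; on terms multiplicativity is \<open>mono_eval_add\<close>.\<close>
lemma poly_eval_mult: "poly_eval c \<sigma> (f * g) = poly_eval c \<sigma> f * poly_eval c \<sigma> g"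
proof -
  have "f * g = (\<Sum>m\<in>Poly_Mapping.keys f. \<Sum>n\<in>Poly_Mapping.keys g.
      Poly_Mapping.single (m + n) (Poly_Mapping.lookup f m * Poly_Mapping.lookup g n))"
    by (subst rpoly_sum_monomials[of f], subst rpoly_sum_monomials[of g])
      (simp add: sum_product mult_single)
  then have "poly_eval c \<sigma> (f * g) = (\<Sum>m\<in>Poly_Mapping.keys f. \<Sum>n\<in>Poly_Mapping.keys g.
      (c (Poly_Mapping.lookup f m) * mono_eval \<sigma> m) * (c (Poly_Mapping.lookup g n) * mono_eval \<sigma> n))"
    by (simp add: poly_eval_sum poly_eval_single c_mult mono_eval_add mult_ac)
  then show ?thesis
    by (simp add: poly_eval_def sum_product)
qed

lemma poly_eval_uminus: "poly_eval c \<sigma> (- f) = - poly_eval c \<sigma> f"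
  using poly_eval_add[of \<sigma> "- f" f] by (simp add: eq_neg_iff_add_eq_0)

lemma poly_eval_diff: "poly_eval c \<sigma> (f - g) = poly_eval c \<sigma> f - poly_eval c \<sigma> g"
  using poly_eval_add[of \<sigma> f "- g"] by (simp add: poly_eval_uminus)

lemma poly_eval_prod: "poly_eval c \<sigma> (\<Prod>i\<in>A. f i) = (\<Prod>i\<in>A. poly_eval c \<sigma> (f i))"
  by (induction A rule: infinite_finite_induct) (auto simp: poly_eval_mult)

lemma poly_eval_power: "poly_eval c \<sigma> (f ^ n) = poly_eval c \<sigma> f ^ n"
  by (induction n) (auto simp: poly_eval_mult)

end

interpretation mconst: scalar_hom mconst
  by unfold_locales simp_all

section \<open>Polynomial rings as structures with a carrier\<close>

lemma mpoly_ring_simps [simp]: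
  "monoid.mult (mpoly_ring X) = (*)" "monoid.one (mpoly_ring X) = 1"
  "ring.zero (mpoly_ring X) = 0" "ring.add (mpoly_ring X) = (+)"
  by (simp_all add: mpoly_ring_def)

lemma mpoly_carrier_iff:
  "f \<in> carrier (mpoly_ring X) \<longleftrightarrow> (\<forall>m\<in>Poly_Mapping.keys f. Poly_Mapping.keys m \<subseteq> X)"
  by (simp add: mpoly_ring_def)

lemma mpoly_const_closed [simp]: "mconst a \<in> carrier (mpoly_ring X)"
  by (auto simp: mpoly_carrier_iff mconst_def)

lemma mpoly_0_closed [simp]: "0 \<in> carrier (mpoly_ring X)"
  using mpoly_const_closed[of 0] by simp

lemma mpoly_1_closed [simp]: "1 \<in> carrier (mpoly_ring X)"
  using mpoly_const_closed[of 1] by simp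

lemma mpoly_var_closed [simp]: "x \<in> X \<Longrightarrow> mvar x \<in> carrier (mpoly_ring X)"
  by (auto simp: mpoly_carrier_iff mvar_def)

lemma mpoly_add_closed [simp]:
  "f \<in> carrier (mpoly_ring X) \<Longrightarrow> g \<in> carrier (mpoly_ring X) \<Longrightarrow> f + g \<in> carrier (mpoly_ring X)"
  unfolding mpoly_carrier_iff using keys_add[of f g] by blast

lemma mpoly_mult_closed [simp]:
  assumes "f \<in> carrier (mpoly_ring X)" "g \<in> carrier (mpoly_ring X)"
  shows "f * g \<in> carrier (mpoly_ring X)"
  unfolding mpoly_carrier_iff
proof
  fix m assume "m \<in> Poly_Mapping.keys (f * g)"
  then obtain a b where "m = a + b" "a \<in> Poly_Mapping.keys f" "b \<in> Poly_Mapping.keys g"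
    using keys_mult[of f g] by blast
  then show "Poly_Mapping.keys m \<subseteq> X"
    using assms keys_add[of a b] unfolding mpoly_carrier_iff by blast
qed

lemma mpoly_uminus_closed [simp]:
  "f \<in> carrier (mpoly_ring X) \<Longrightarrow> - f \<in> carrier (mpoly_ring X)"
  by (simp add: mpoly_carrier_iff)

lemma mpoly_diff_closed [simp]:
  "f \<in> carrier (mpoly_ring X) \<Longrightarrow> g \<in> carrier (mpoly_ring X) \<Longrightarrow> f - g \<in> carrier (mpoly_ring X)"
  using mpoly_add_closed[of f X "- g"] by simp

lemma mpoly_sum_closed [simp]:
  "(\<And>i. i \<in> A \<Longrightarrow> f i \<in> carrier (mpoly_ring X)) \<Longrightarrow> (\<Sum>i\<in>A. f i) \<in> carrier (mpoly_ring X)"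
  by (induction A rule: infinite_finite_induct) auto

lemma mpoly_prod_closed [simp]:
  "(\<And>i. i \<in> A \<Longrightarrow> f i \<in> carrier (mpoly_ring X)) \<Longrightarrow> (\<Prod>i\<in>A. f i) \<in> carrier (mpoly_ring X)"
  by (induction A rule: infinite_finite_induct) auto

lemma mpoly_power_closed [simp]:
  "f \<in> carrier (mpoly_ring X) \<Longrightarrow> f ^ n \<in> carrier (mpoly_ring X)"
  by (induction n) auto

lemma cring_mpoly_ring: "cring (mpoly_ring X)"
  by (rule cringI, rule abelian_groupI, auto intro!: comm_monoidI simp: algebra_simps)
    (metis ab_left_minus add.commute mpoly_uminus_closed)

lemma mpoly_pow [simp]: "f [^]\<^bsub>mpoly_ring X\<^esub> (n::nat) = f ^ n"
  by (induction n) (simp_all add: nat_pow_def mult.commute)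

lemma mpoly_a_inv [simp]:
  assumes "f \<in> carrier (mpoly_ring X)" shows "\<ominus>\<^bsub>mpoly_ring X\<^esub> f = - f"
proof -
  interpret cring "mpoly_ring X" by (rule cring_mpoly_ring)
  show ?thesis using assms by (intro minus_equality) auto
qed

lemma mpoly_a_minus [simp]:
  assumes "g \<in> carrier (mpoly_ring X)" shows "f \<ominus>\<^bsub>mpoly_ring X\<^esub> g = f - g"
  using assms by (simp add: a_minus_def)

text \<open>Used above all for comparing substitutions, which then need to be compared on variables only.\<close>
lemma mpoly_induct [consumes 1, case_names const var add mult]:
  assumes "f \<in> carrier (mpoly_ring X)"
    and const: "\<And>a. P (mconst a)"
    and var: "\<And>x. x \<in> X \<Longrightarrow> P (mvar x)"
    and add: "\<And>f g. f \<in> carrier (mpoly_ring X) \<Longrightarrow> g \<in> carrier (mpoly_ring X) \<Longrightarrow> P f \<Longrightarrow> P g \<Longrightarrow> P (f + g)"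
    and mult: "\<And>f g. f \<in> carrier (mpoly_ring X) \<Longrightarrow> g \<in> carrier (mpoly_ring X) \<Longrightarrow> P f \<Longrightarrow> P g \<Longrightarrow> P (f * g)"
  shows "P f"
proof -
  let ?Q = "\<lambda>f. f \<in> carrier (mpoly_ring X) \<and> P f"
  have 0: "?Q 0" and 1: "?Q 1"
    using const[of 0] const[of 1] by auto
  have power: "?Q (f ^ n)" if "?Q f" for f n
    using that 1 mult by (induction n) auto
  have prod: "?Q (\<Prod>i\<in>A. h i)" if "finite A" "\<And>i. i \<in> A \<Longrightarrow> ?Q (h i)" for A and h :: "'a \<Rightarrow> 'a rpoly"
    using that by (induction A) (use 1 mult in auto)
  have sum: "?Q (\<Sum>i\<in>A. h i)" if "finite A" "\<And>i. i \<in> A \<Longrightarrow> ?Q (h i)"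
    for A and h :: "('a \<Rightarrow>\<^sub>0 nat) \<Rightarrow> 'a rpoly"
    using that by (induction A) (use 0 add in auto)
  have "?Q (\<Sum>m\<in>Poly_Mapping.keys f. mconst (Poly_Mapping.lookup f m) * mono_eval mvar m)"
  proof (rule sum)
    fix m assume "m \<in> Poly_Mapping.keys f"
    then have "Poly_Mapping.keys m \<subseteq> X"
      using assms(1) by (auto simp: mpoly_carrier_iff)
    then have "?Q (mono_eval mvar m)"
      unfolding mono_eval_def using var by (intro prod power) auto
    then show "?Q (mconst (Poly_Mapping.lookup f m) * mono_eval mvar m)"
      using const mult by auto
  qed simp
  then show ?thesis
    using rpoly_sum_monomials[of f] by (simp add: single_eq_mono_eval)
qed

lemma (in scalar_hom) poly_eval_msubst:
  assumes "f \<in> carrier (mpoly_ring X)"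
  shows "poly_eval c \<tau> (msubst \<sigma> f) = poly_eval c (\<lambda>x. poly_eval c \<tau> (\<sigma> x)) f"
  using assms unfolding msubst_eq_poly_eval
  by (induction rule: mpoly_induct)
    (simp_all add: poly_eval_add poly_eval_mult mconst.poly_eval_add mconst.poly_eval_mult)

section \<open>Homogeneous polynomials\<close>

lemma monomial_degree_add:
  "(\<Sum>x\<in>Poly_Mapping.keys (m + n). Poly_Mapping.lookup (m + n) x) =
    (\<Sum>x\<in>Poly_Mapping.keys m. Poly_Mapping.lookup m x) + (\<Sum>x\<in>Poly_Mapping.keys n. Poly_Mapping.lookup (n :: 'x \<Rightarrow>\<^sub>0 nat) x)"
proof -
  let ?A = "Poly_Mapping.keys m \<union> Poly_Mapping.keys n"
  have *: "(\<Sum>x\<in>Poly_Mapping.keys k. Poly_Mapping.lookup k x) = (\<Sum>x\<in>?A. Poly_Mapping.lookup k x)"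
    if "Poly_Mapping.keys k \<subseteq> ?A" for k :: "'x \<Rightarrow>\<^sub>0 nat"
    by (rule sum.mono_neutral_left) (use that in \<open>auto simp: in_keys_iff\<close>)
  show ?thesis
    using *[of "m + n"] *[of m] *[of n] keys_add[of m n] by (simp add: lookup_add sum.distrib)
qed

lemma homogeneous_mconst: "homogeneous 0 (mconst a)"
  by (simp add: homogeneous_def mconst_def)

lemma homogeneous_mvar: "homogeneous 1 (mvar x)"
  by (simp add: homogeneous_def mvar_def)

lemma homogeneous_add: "homogeneous d f \<Longrightarrow> homogeneous d g \<Longrightarrow> homogeneous d (f + g)"
  unfolding homogeneous_def using keys_add[of f g] by blast

lemma homogeneous_mult: 
  assumes "homogeneous d f" "homogeneous e g" shows "homogeneous (d + e) (f * g)"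
  unfolding homogeneous_def
proof
  fix m assume "m \<in> Poly_Mapping.keys (f * g)"
  then obtain a b where "m = a + b" "a \<in> Poly_Mapping.keys f" "b \<in> Poly_Mapping.keys g"
    using keys_mult[of f g] by blast
  then show "(\<Sum>x\<in>Poly_Mapping.keys m. Poly_Mapping.lookup m x) = d + e"
    using assms by (simp add: homogeneous_def monomial_degree_add)
qed

lemma homogeneous_uminus: "homogeneous d f \<Longrightarrow> homogeneous d (- f)"
  by (simp add: homogeneous_def)

lemma homogeneous_diff: "homogeneous d f \<Longrightarrow> homogeneous d g \<Longrightarrow> homogeneous d (f - g)"
  using homogeneous_add[of d f "- g"] by (simp add: homogeneous_uminus)

lemma homogeneous_0: "homogeneous d 0"
  by (simp add: homogeneous_def)

lemma homogeneous_1: "homogeneous 0 1"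
  using homogeneous_mconst[of 1] by simp

lemma homogeneous_sum: "(\<And>i. i \<in> A \<Longrightarrow> homogeneous d (f i)) \<Longrightarrow> homogeneous d (\<Sum>i\<in>A. f i)"
  by (induction A rule: infinite_finite_induct) (auto simp: homogeneous_0 homogeneous_add)

lemma homogeneous_prod:
  "(\<And>i. i \<in> A \<Longrightarrow> homogeneous 1 (f i)) \<Longrightarrow> homogeneous (card A) (\<Prod>i\<in>A. f i)"
proof (induction A rule: infinite_finite_induct)
  case (insert x A)
  then show ?case using homogeneous_mult[of 1 "f x" "card A"] by simp
qed (auto simp: homogeneous_1)

lemma homogeneous_power: "homogeneous d f \<Longrightarrow> homogeneous (k * d) (f ^ k)"
  by (induction k) (auto simp: homogeneous_1 intro: homogeneous_mult)

text \<open>Scaling all values by \<open>s\<close> is how \<open>f / p\<^sub>r\<^sup>n\<close> is cleared of its denominator when \<open>f\<close> is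
  homogeneous of degree \<open>n\<close>.\<close>
lemma (in scalar_hom) poly_eval_scale:
  assumes "homogeneous d f"
  shows "poly_eval c (\<lambda>x. s * \<sigma> x) f = s ^ d * poly_eval c \<sigma> f"
proof -
  have "mono_eval (\<lambda>x. s * \<sigma> x) m = s ^ d * mono_eval \<sigma> m" if "m \<in> Poly_Mapping.keys f" for m
    using assms that
    by (auto simp: mono_eval_def homogeneous_def power_mult_distrib prod.distrib power_sum)
  then show ?thesis
    by (simp add: poly_eval_def sum_distrib_left mult_ac)
qed

section \<open>Localisation at the powers of an element\<close>

locale localisation = cring R for R (structure) +
  fixes x
  assumes x_closed [simp]: "x \<in> carrier R"
begin

lemma powersI [simp]: "x [^] (n::nat) \<in> powers R x"
  by (auto simp: powers_def)

lemma powersE: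
  assumes "s \<in> powers R x" obtains n :: nat where "s = x [^] n"
  using assms by (auto simp: powers_def)

lemma Bex_powers: "(\<exists>s\<in>powers R x. P s) \<longleftrightarrow> (\<exists>n::nat. P (x [^] n))"
  by (auto simp: powers_def)

lemma powers_closed [simp]: "s \<in> powers R x \<Longrightarrow> s \<in> carrier R"
  by (auto simp: powers_def)

lemma one_in_powers [simp]: "\<one> \<in> powers R x"
  using powersI[of 0] by simp

lemma mult_in_powers [simp]: "s \<in> powers R x \<Longrightarrow> t \<in> powers R x \<Longrightarrow> s \<otimes> t \<in> powers R x"
  by (auto simp: powers_def nat_pow_mult)

text \<open>Transitivity is what the extra multiplier \<open>u\<close> of the relation is for: from multipliers
  \<open>u\<close> and \<open>v\<close> and the middle denominator \<open>t\<close> one gets the multiplier \<open>u v t\<close>.\<close>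
lemma equiv_loc_rel: "equiv (carrier R \<times> powers R x) (loc_rel R x)"
proof (rule equivI)
  show "loc_rel R x \<subseteq> (carrier R \<times> powers R x) \<times> (carrier R \<times> powers R x)"
    by (auto simp: loc_rel_def)
  show "refl_on (carrier R \<times> powers R x) (loc_rel R x)"
    by (rule refl_onI) (auto simp: loc_rel_def)
  show "sym (loc_rel R x)"
    by (rule symI) (auto simp: loc_rel_def intro: sym)
  show "trans (loc_rel R x)"
  proof (rule transI)
    fix p q r assume "(p, q) \<in> loc_rel R x" "(q, r) \<in> loc_rel R x"
    then obtain a s b t c w u v where eq: "p = (a, s)" "q = (b, t)" "r = (c, w)"
      and [simp]: "a \<in> carrier R" "b \<in> carrier R" "c \<in> carrier R"
        "s \<in> powers R x" "t \<in> powers R x" "w \<in> powers R x" "u \<in> powers R x" "v \<in> powers R x"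
      and 1: "u \<otimes> (t \<otimes> a) = u \<otimes> (s \<otimes> b)" and 2: "v \<otimes> (w \<otimes> b) = v \<otimes> (t \<otimes> c)"
      by (auto simp: loc_rel_def)
    have "(u \<otimes> v \<otimes> t) \<otimes> (w \<otimes> a) = (v \<otimes> w) \<otimes> (u \<otimes> (t \<otimes> a))"
      by (simp add: m_ac)
    also have "\<dots> = (u \<otimes> s) \<otimes> (v \<otimes> (w \<otimes> b))"
      unfolding 1 by (simp add: m_ac)
    also have "\<dots> = (u \<otimes> v \<otimes> t) \<otimes> (s \<otimes> c)"
      unfolding 2 by (simp add: m_ac)
    finally have "\<exists>z\<in>powers R x. z \<otimes> (w \<otimes> a) = z \<otimes> (s \<otimes> c)"
      by (intro bexI[of _ "u \<otimes> v \<otimes> t"]) auto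
    then show "(p, r) \<in> loc_rel R x"
      by (simp add: loc_rel_def eq)
  qed
qed

lemma loc_frac_eq_iff:
  assumes "a \<in> carrier R" "b \<in> carrier R" "s \<in> powers R x" "t \<in> powers R x"
  shows "loc_frac R x a s = loc_frac R x b t \<longleftrightarrow> (\<exists>u\<in>powers R x. u \<otimes> (t \<otimes> a) = u \<otimes> (s \<otimes> b))"
  using eq_equiv_class_iff[OF equiv_loc_rel, of "(a, s)" "(b, t)"] assms
  by (auto simp: loc_frac_def loc_rel_def)

lemma loc_frac_closed [simp]:
  "a \<in> carrier R \<Longrightarrow> s \<in> powers R x \<Longrightarrow> loc_frac R x a s \<in> carrier (localise R x)"
  unfolding localise_def loc_frac_def by (auto intro!: quotientI)

lemma loc_frac_cases:
  assumes "X \<in> carrier (localise R x)"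
  obtains a s where "a \<in> carrier R" "s \<in> powers R x" "X = loc_frac R x a s"
  using assms unfolding localise_def loc_frac_def by (auto elim!: quotientE)

lemma mem_loc_frac:
  assumes "(b, t) \<in> loc_frac R x a s"
  shows "b \<in> carrier R" "t \<in> powers R x" "loc_frac R x b t = loc_frac R x a s"
proof -
  have *: "((a, s), (b, t)) \<in> loc_rel R x"
    using assms by (simp add: loc_frac_def)
  then show "b \<in> carrier R" "t \<in> powers R x"
    by (auto simp: loc_rel_def)
  show "loc_frac R x b t = loc_frac R x a s"
    using equiv_class_eq[OF equiv_loc_rel *] by (simp add: loc_frac_def)
qed

lemma self_in_loc_frac: "a \<in> carrier R \<Longrightarrow> s \<in> powers R x \<Longrightarrow> (a, s) \<in> loc_frac R x a s"
  by (auto simp: loc_frac_def loc_rel_def)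

lemma loc_frac_mult_cong:
  assumes "a \<in> carrier R" "s \<in> powers R x" "b \<in> carrier R" "t \<in> powers R x"
    and "a' \<in> carrier R" "s' \<in> powers R x" "b' \<in> carrier R" "t' \<in> powers R x"
    and "loc_frac R x a s = loc_frac R x a' s'" "loc_frac R x b t = loc_frac R x b' t'"
  shows "loc_frac R x (a \<otimes> b) (s \<otimes> t) = loc_frac R x (a' \<otimes> b') (s' \<otimes> t')"
proof -
  note [simp] = assms(1-8)
  obtain u v where [simp]: "u \<in> powers R x" "v \<in> powers R x"
    and 1: "u \<otimes> (s' \<otimes> a) = u \<otimes> (s \<otimes> a')" and 2: "v \<otimes> (t' \<otimes> b) = v \<otimes> (t \<otimes> b')"
    using assms by (auto simp: loc_frac_eq_iff)
  have "(u \<otimes> v) \<otimes> ((s' \<otimes> t') \<otimes> (a \<otimes> b)) = (u \<otimes> (s' \<otimes> a)) \<otimes> (v \<otimes> (t' \<otimes> b))"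
    by (simp add: m_ac)
  also have "\<dots> = (u \<otimes> v) \<otimes> ((s \<otimes> t) \<otimes> (a' \<otimes> b'))"
    unfolding 1 2 by (simp add: m_ac)
  finally show ?thesis
    by (subst loc_frac_eq_iff) (auto intro!: bexI[of _ "u \<otimes> v"])
qed

lemma loc_frac_add_cong:
  assumes "a \<in> carrier R" "s \<in> powers R x" "b \<in> carrier R" "t \<in> powers R x"
    and "a' \<in> carrier R" "s' \<in> powers R x" "b' \<in> carrier R" "t' \<in> powers R x"
    and "loc_frac R x a s = loc_frac R x a' s'" "loc_frac R x b t = loc_frac R x b' t'"
  shows "loc_frac R x (t \<otimes> a \<oplus> s \<otimes> b) (s \<otimes> t) = loc_frac R x (t' \<otimes> a' \<oplus> s' \<otimes> b') (s' \<otimes> t')"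
proof -
  note [simp] = assms(1-8)
  obtain u v where [simp]: "u \<in> powers R x" "v \<in> powers R x"
    and 1: "u \<otimes> (s' \<otimes> a) = u \<otimes> (s \<otimes> a')" and 2: "v \<otimes> (t' \<otimes> b) = v \<otimes> (t \<otimes> b')"
    using assms by (auto simp: loc_frac_eq_iff)
  have "(u \<otimes> v) \<otimes> ((s' \<otimes> t') \<otimes> (t \<otimes> a \<oplus> s \<otimes> b)) =
      (v \<otimes> t \<otimes> t') \<otimes> (u \<otimes> (s' \<otimes> a)) \<oplus> (u \<otimes> s \<otimes> s') \<otimes> (v \<otimes> (t' \<otimes> b))"
    by (simp add: m_ac r_distr)
  also have "\<dots> = (u \<otimes> v) \<otimes> ((s \<otimes> t) \<otimes> (t' \<otimes> a' \<oplus> s' \<otimes> b'))"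
    unfolding 1 2 by (simp add: m_ac r_distr)
  finally show ?thesis
    by (subst loc_frac_eq_iff) (auto intro!: bexI[of _ "u \<otimes> v"])
qed

text \<open>The operations of \<open>localise\<close> are unions over all representatives. When the summand does not
  depend on the representatives, the union collapses to the value at any one of them.\<close>
lemma UN_loc_frac:
  assumes "a \<in> carrier R" "s \<in> powers R x" "b \<in> carrier R" "t \<in> powers R x"
    and "\<And>a' s' b' t'. (a', s') \<in> loc_frac R x a s \<Longrightarrow> (b', t') \<in> loc_frac R x b t \<Longrightarrow>
      F a' s' b' t' = F a s b t"
  shows "(\<Union>(a, s)\<in>loc_frac R x a s. \<Union>(b, t)\<in>loc_frac R x b t. F a s b t) = F a s b t"
proof -
  have "(\<Union>(a, s)\<in>loc_frac R x a s. \<Union>(b, t)\<in>loc_frac R x b t. F a s b t) =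
      (\<Union>p\<in>loc_frac R x a s. \<Union>q\<in>loc_frac R x b t. F a s b t)"
    using assms(5) by (intro SUP_cong refl) auto
  moreover have "loc_frac R x a s \<noteq> {}" "loc_frac R x b t \<noteq> {}"
    using self_in_loc_frac[OF assms(1,2)] self_in_loc_frac[OF assms(3,4)] by blast+
  ultimately show ?thesis
    by simp
qed

lemma localise_mult:
  assumes "a \<in> carrier R" "s \<in> powers R x" "b \<in> carrier R" "t \<in> powers R x"
  shows "loc_frac R x a s \<otimes>\<^bsub>localise R x\<^esub> loc_frac R x b t = loc_frac R x (a \<otimes> b) (s \<otimes> t)"
  unfolding localise_def monoid.simps
  by (rule UN_loc_frac[OF assms, of "\<lambda>a s b t. loc_frac R x (a \<otimes> b) (s \<otimes> t)"])
    (rule loc_frac_mult_cong, use assms in \<open>auto dest: mem_loc_frac\<close>)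

lemma localise_add:
  assumes "a \<in> carrier R" "s \<in> powers R x" "b \<in> carrier R" "t \<in> powers R x"
  shows "loc_frac R x a s \<oplus>\<^bsub>localise R x\<^esub> loc_frac R x b t =
    loc_frac R x (t \<otimes> a \<oplus> s \<otimes> b) (s \<otimes> t)"
  unfolding localise_def ring.simps
  by (rule UN_loc_frac[OF assms, of "\<lambda>a s b t. loc_frac R x (t \<otimes> a \<oplus> s \<otimes> b) (s \<otimes> t)"])
    (rule loc_frac_add_cong, use assms in \<open>auto dest: mem_loc_frac\<close>)

lemma localise_one: "\<one>\<^bsub>localise R x\<^esub> = loc_frac R x \<one> \<one>"
  by (simp add: localise_def)

text \<open>If a power of \<open>x\<close> multiplies \<open>a\<close> into \<open>I\<close>, then \<open>a / s\<close> expands to a fraction with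
  numerator in \<open>I\<close>.\<close>
lemma loc_ideal_eqI:
  assumes "I \<subseteq> I'" "I' \<subseteq> carrier R" "\<And>a. a \<in> I' \<Longrightarrow> \<exists>n::nat. x [^] n \<otimes> a \<in> I"
  shows "loc_ideal R x I' = loc_ideal R x I"
proof
  show "loc_ideal R x I \<subseteq> loc_ideal R x I'"
    using assms(1) by (auto simp: loc_ideal_def)
  show "loc_ideal R x I' \<subseteq> loc_ideal R x I"
  proof
    fix X assume "X \<in> loc_ideal R x I'"
    then obtain a s where X: "X = loc_frac R x a s" and a: "a \<in> I'" and s: "s \<in> powers R x"
      by (auto simp: loc_ideal_def)
    obtain n :: nat where n: "x [^] n \<otimes> a \<in> I"
      using assms(3)[OF a] by blast
    have "a \<in> carrier R"
      using a assms(2) by blast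
    then have "X = loc_frac R x (x [^] n \<otimes> a) (x [^] n \<otimes> s)"
      unfolding X using s
      by (subst loc_frac_eq_iff) (use one_in_powers in \<open>auto simp: m_ac simp del: one_in_powers\<close>)
    moreover have "x [^] n \<otimes> s \<in> powers R x"
      using s by simp
    ultimately show "X \<in> loc_ideal R x I"
      using n unfolding loc_ideal_def by blast
  qed
qed

end

locale localised_hom = localisation R x + S: cring S
  for R (structure) and x and S (structure) +
  fixes h
  assumes hom: "h \<in> ring_hom R S"
begin

sublocale S: localisation S "h x"
  using ring_hom_closed[OF hom] by unfold_locales auto

lemma hom_pow [simp]: "a \<in> carrier R \<Longrightarrow> h (a [^]\<^bsub>R\<^esub> (n::nat)) = h a [^]\<^bsub>S\<^esub> n"
  by (induction n) (use ring_hom_mult[OF hom] ring_hom_one[OF hom] in auto)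

lemma hom_powers [simp]: "s \<in> powers R x \<Longrightarrow> h s \<in> powers S (h x)"
  by (auto elim!: powersE)

lemma hom_closed [simp]: "a \<in> carrier R \<Longrightarrow> h a \<in> carrier S"
  using ring_hom_closed[OF hom] by auto

lemma loc_frac_hom_cong:
  assumes "a \<in> carrier R" "s \<in> powers R x" "b \<in> carrier R" "t \<in> powers R x"
    and "loc_frac R x a s = loc_frac R x b t"
  shows "loc_frac S (h x) (h a) (h s) = loc_frac S (h x) (h b) (h t)"
proof -
  obtain u where u: "u \<in> powers R x" "u \<otimes>\<^bsub>R\<^esub> (t \<otimes>\<^bsub>R\<^esub> a) = u \<otimes>\<^bsub>R\<^esub> (s \<otimes>\<^bsub>R\<^esub> b)"
    using assms by (auto simp: loc_frac_eq_iff)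
  have "h (u \<otimes>\<^bsub>R\<^esub> (t \<otimes>\<^bsub>R\<^esub> a)) = h (u \<otimes>\<^bsub>R\<^esub> (s \<otimes>\<^bsub>R\<^esub> b))"
    using u(2) by simp
  then have "h u \<otimes>\<^bsub>S\<^esub> (h t \<otimes>\<^bsub>S\<^esub> h a) = h u \<otimes>\<^bsub>S\<^esub> (h s \<otimes>\<^bsub>S\<^esub> h b)"
    using assms u(1) by (simp add: ring_hom_mult[OF hom])
  then show ?thesis
    using assms u(1) by (subst S.loc_frac_eq_iff) (auto intro!: bexI[of _ "h u"])
qed

lemma loc_map_frac:
  assumes "a \<in> carrier R" "s \<in> powers R x"
  shows "loc_map S (h x) h (loc_frac R x a s) = loc_frac S (h x) (h a) (h s)"
proof -
  have "loc_frac S (h x) (h b) (h t) = loc_frac S (h x) (h a) (h s)"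
    if "(b, t) \<in> loc_frac R x a s" for b t
    using mem_loc_frac[OF that] assms by (intro loc_frac_hom_cong)
  then have "(\<lambda>(a, s). loc_frac S (h x) (h a) (h s)) ` loc_frac R x a s =
      (\<lambda>_. loc_frac S (h x) (h a) (h s)) ` loc_frac R x a s"
    by (intro image_cong refl) auto
  also have "\<dots> = {loc_frac S (h x) (h a) (h s)}"
    using self_in_loc_frac[OF assms] by blast
  finally have "(\<lambda>(a, s). loc_frac S (h x) (h a) (h s)) ` loc_frac R x a s = {loc_frac S (h x) (h a) (h s)}" .
  then show ?thesis
    by (simp add: loc_map_def)
qed

lemma loc_map_hom: "loc_map S (h x) h \<in> ring_hom (localise R x) (localise S (h x))"
proof (rule ring_hom_memI)
  show "loc_map S (h x) h X \<in> carrier (localise S (h x))" if "X \<in> carrier (localise R x)" for X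
    using that by (auto elim!: loc_frac_cases simp: loc_map_frac)
  show "loc_map S (h x) h (X \<otimes>\<^bsub>localise R x\<^esub> Y) =
      loc_map S (h x) h X \<otimes>\<^bsub>localise S (h x)\<^esub> loc_map S (h x) h Y"
    if "X \<in> carrier (localise R x)" "Y \<in> carrier (localise R x)" for X Y
    using that
    by (auto elim!: loc_frac_cases simp: loc_map_frac localise_mult S.localise_mult ring_hom_mult[OF hom])
  show "loc_map S (h x) h (X \<oplus>\<^bsub>localise R x\<^esub> Y) =
      loc_map S (h x) h X \<oplus>\<^bsub>localise S (h x)\<^esub> loc_map S (h x) h Y"
    if "X \<in> carrier (localise R x)" "Y \<in> carrier (localise R x)" for X Y
    using that
    by (auto elim!: loc_frac_cases
        simp: loc_map_frac localise_add S.localise_add ring_hom_mult[OF hom] ring_hom_add[OF hom])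
  show "loc_map S (h x) h \<one>\<^bsub>localise R x\<^esub> = \<one>\<^bsub>localise S (h x)\<^esub>"
    by (simp add: localise_one S.localise_one loc_map_frac ring_hom_one[OF hom])
qed

end

section \<open>Maps induced on quotients\<close>

lemma quot_carrierE:
  assumes "C \<in> carrier (R Quot J)"
  obtains a where "a \<in> carrier R" "C = J +>\<^bsub>R\<^esub> a"
  using assms by (auto simp: FactRing_def A_RCOSETS_def')

text \<open>The kernel of \<open>h\<close> may be larger than \<open>J\<close>, as it is for the ideal of invariants, so the
  isomorphism theorem does not apply; containment makes \<open>h\<close> constant on cosets.\<close>
lemma quot_map_coset:
  assumes "ideal J R" "ring S" "h \<in> ring_hom R S" "\<And>a. a \<in> J \<Longrightarrow> h a = \<zero>\<^bsub>S\<^esub>" "a \<in> carrier R"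
  shows "quot_map h (J +>\<^bsub>R\<^esub> a) = h a"
proof -
  interpret ideal J R by fact
  interpret S: ring S by fact
  have "h (j \<oplus>\<^bsub>R\<^esub> a) = h a" if "j \<in> J" for j
    using that assms(5) ring_hom_closed[OF assms(3), of a]
    by (simp add: ring_hom_add[OF assms(3)] assms(4))
  then have "h ` (J +>\<^bsub>R\<^esub> a) \<subseteq> {h a}"
    by (auto simp: a_r_coset_def')
  then have "h ` (J +>\<^bsub>R\<^esub> a) = {h a}"
    using a_rcos_self[OF assms(5)] by blast
  then show ?thesis
    by (simp add: quot_map_def)
qed

lemma quot_map_hom:
  assumes "ideal J R" "ring S" "h \<in> ring_hom R S" "\<And>a. a \<in> J \<Longrightarrow> h a = \<zero>\<^bsub>S\<^esub>"
  shows "quot_map h \<in> ring_hom (R Quot J) S"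
proof -
  interpret ideal J R by fact
  note coset = quot_map_coset[OF assms]
  have mult: "(J +>\<^bsub>R\<^esub> a) \<otimes>\<^bsub>R Quot J\<^esub> (J +>\<^bsub>R\<^esub> b) = J +>\<^bsub>R\<^esub> (a \<otimes>\<^bsub>R\<^esub> b)"
    if "a \<in> carrier R" "b \<in> carrier R" for a b
    using that by (simp add: FactRing_def rcoset_mult_add)
  have add: "(J +>\<^bsub>R\<^esub> a) \<oplus>\<^bsub>R Quot J\<^esub> (J +>\<^bsub>R\<^esub> b) = J +>\<^bsub>R\<^esub> (a \<oplus>\<^bsub>R\<^esub> b)"
    if "a \<in> carrier R" "b \<in> carrier R" for a b
    using that by (simp add: FactRing_def a_rcos_sum)
  have one: "\<one>\<^bsub>R Quot J\<^esub> = J +>\<^bsub>R\<^esub> \<one>\<^bsub>R\<^esub>"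
    by (simp add: FactRing_def)
  show ?thesis
    by (rule ring_hom_memI)
      (auto elim!: quot_carrierE simp: coset mult add one ring_hom_closed[OF assms(3)]
        ring_hom_mult[OF assms(3)] ring_hom_add[OF assms(3)] ring_hom_one[OF assms(3)])
qed

section \<open>Ideals of polynomial rings\<close>
locale mpoly_ideal = ideal I "mpoly_ring X" for I :: "'x rpoly set" and X
begin

lemma I_carrier: "f \<in> I \<Longrightarrow> f \<in> carrier (mpoly_ring X)"
  using a_subset by auto

lemma I_0 [simp]: "0 \<in> I"
  using additive_subgroup.zero_closed[OF is_additive_subgroup] by simp

lemma I_add: "f \<in> I \<Longrightarrow> g \<in> I \<Longrightarrow> f + g \<in> I"
  using additive_subgroup.a_closed[OF is_additive_subgroup] by simp

lemma I_mult: "f \<in> carrier (mpoly_ring X) \<Longrightarrow> g \<in> I \<Longrightarrow> f * g \<in> I"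
  using I_l_closed by simp

lemma I_uminus: "f \<in> I \<Longrightarrow> - f \<in> I"
  using I_mult[of "- 1" f] by simp

lemma I_diff: "f \<in> I \<Longrightarrow> g \<in> I \<Longrightarrow> f - g \<in> I"
  using I_add[of f "- g"] I_uminus by simp

lemma I_sum: "(\<And>i. i \<in> A \<Longrightarrow> f i \<in> I) \<Longrightarrow> (\<Sum>i\<in>A. f i) \<in> I"
  by (induction A rule: infinite_finite_induct) (auto simp: I_add)

lemma coset_eq_iff:
  assumes "f \<in> carrier (mpoly_ring X)" "g \<in> carrier (mpoly_ring X)"
  shows "I +>\<^bsub>mpoly_ring X\<^esub> f = I +>\<^bsub>mpoly_ring X\<^esub> g \<longleftrightarrow> f - g \<in> I"
  using quotient_eq_iff_same_a_r_cos[OF ideal_axioms assms] assms by simp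

end

lemma mpoly_ideal_genideal:
  assumes "S \<subseteq> carrier (mpoly_ring X)"
  shows "mpoly_ideal (Idl\<^bsub>mpoly_ring X\<^esub> S) X"
  using assms cring.axioms(1)[OF cring_mpoly_ring] 
  by (auto simp: mpoly_ideal_def intro: ring.genideal_ideal)

lemma mpoly_genideal_minimal:
  assumes "mpoly_ideal I X" "S \<subseteq> I"
  shows "Idl\<^bsub>mpoly_ring X\<^esub> S \<subseteq> I"
  using assms cring.axioms(1)[OF cring_mpoly_ring]
  by (auto simp: mpoly_ideal_def dest: ring.genideal_minimal)

lemma mpoly_genideal_self:
  assumes "S \<subseteq> carrier (mpoly_ring X)" shows "S \<subseteq> Idl\<^bsub>mpoly_ring X\<^esub> S"
  using assms cring.axioms(1)[OF cring_mpoly_ring] by (auto dest: ring.genideal_self)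

lemma mpoly_idealI:
  assumes "I \<subseteq> carrier (mpoly_ring X)" "0 \<in> I"
    and "\<And>f g. f \<in> I \<Longrightarrow> g \<in> I \<Longrightarrow> f + g \<in> I"
    and "\<And>f g. f \<in> carrier (mpoly_ring X) \<Longrightarrow> g \<in> I \<Longrightarrow> f * g \<in> I"
  shows "mpoly_ideal I X"
proof -
  interpret cring "mpoly_ring X" by (rule cring_mpoly_ring)
  have uminus: "- f \<in> I" if "f \<in> I" for f
    using assms(4)[of "- 1" f] that by simp
  have "subgroup I (add_monoid (mpoly_ring X))"
  proof (rule add.subgroupI)
    show "\<ominus>\<^bsub>mpoly_ring X\<^esub> f \<in> I" if "f \<in> I" for f
      using that uminus assms(1) by auto
  qed (use assms in auto)
  then have "ideal I (mpoly_ring X)"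
    by (rule idealI[OF ring_axioms]) (use assms(4) in \<open>simp_all\<close>, metis mult.commute)
  then show ?thesis
    by (simp add: mpoly_ideal_def)
qed

section \<open>Inverting an element modulo an ideal\<close>

text \<open>The value of \<open>h\<close> at \<open>1 / d\<close>, multiplied by \<open>d ^ n\<close>. This is a genuine value only for
  \<open>n \<ge> degree h\<close>; for smaller \<open>n\<close> coefficients are lost.\<close>
definition clear_denom :: "'r::comm_ring_1 \<Rightarrow> nat \<Rightarrow> 'r poly \<Rightarrow> 'r" where
  "clear_denom d n h = (\<Sum>i\<le>n. coeff h i * d ^ (n - i))"

lemma clear_denom_add: "clear_denom d n (g + h) = clear_denom d n g + clear_denom d n h"
  by (simp add: clear_denom_def distrib_right sum.distrib)

lemma clear_denom_smult: "clear_denom d n (smult a h) = a * clear_denom d n h"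
  by (simp add: clear_denom_def sum_distrib_left mult.assoc)

lemma clear_denom_pCons_0: "clear_denom d (Suc n) (pCons 0 h) = clear_denom d n h"
  by (simp add: clear_denom_def sum.atMost_Suc_shift del: sum.atMost_Suc)

lemma clear_denom_const: "clear_denom d n [:f:] = f * d ^ n"
proof (cases n)
  case (Suc m)
  then show ?thesis by (simp add: clear_denom_def sum.atMost_Suc_shift del: sum.atMost_Suc)
qed (simp add: clear_denom_def)

text \<open>Beyond the degree, each increase of the exponent multiplies the value by \<open>d\<close>, so membership in
  an ideal persists for all larger exponents.\<close>
lemma clear_denom_mono:
  assumes "degree h \<le> n"
  shows "clear_denom d (n + k) h = d ^ k * clear_denom d n h"
proof (induction k)
  case (Suc k)
  have "clear_denom d (Suc (n + k)) h = d * clear_denom d (n + k) h"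
    using assms by (auto simp: clear_denom_def sum_distrib_left coeff_eq_0 Suc_diff_le mult_ac
      intro!: sum.cong)
  then show ?case
    by (simp add: Suc.IH mult.assoc)
qed simp

locale inverting = mpoly_ideal I X for I :: "'x rpoly set" and X +
  fixes d
  assumes d_closed [simp]: "d \<in> carrier (mpoly_ring X)"
begin

text \<open>The polynomials in \<open>t\<close> that vanish at \<open>t = 1 / d\<close> in the localisation at \<open>d\<close> of the quotient by
  \<open>I\<close>. Calculations with fractions modulo \<open>I\<close> become congruences modulo this set.\<close>
definition inv_ideal :: "'x rpoly poly set" where
  "inv_ideal = {h. \<exists>n\<ge>degree h. clear_denom d n h \<in> I}"

text \<open>The type admits coefficients with variables outside \<open>X\<close>, but \<open>I\<close> is an ideal of the polynomial
  ring in \<open>X\<close> only.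
  So \<open>inv_ideal\<close> absorbs multiplication by elements of this set.\<close>
definition polys :: "'x rpoly poly set" where
  "polys = {h. \<forall>i. coeff h i \<in> carrier (mpoly_ring X)}"

lemma inv_ideal_eventually:
  assumes "h \<in> inv_ideal"
  obtains n where "\<And>m. m \<ge> n \<Longrightarrow> m \<ge> degree h \<and> clear_denom d m h \<in> I"
proof -
  obtain n where n: "degree h \<le> n" "clear_denom d n h \<in> I"
    using assms by (auto simp: inv_ideal_def)
  have "clear_denom d m h \<in> I" if "m \<ge> n" for m
    using clear_denom_mono[OF n(1), of d "m - n"] that n(2) by (simp add: I_mult)
  then show ?thesis
    using that[of n] n(1) by auto
qed

lemma inv_ideal_add:
  assumes "g \<in> inv_ideal" "h \<in> inv_ideal" shows "g + h \<in> inv_ideal"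
proof -
  obtain m where m: "\<And>k. k \<ge> m \<Longrightarrow> k \<ge> degree g \<and> clear_denom d k g \<in> I"
    using inv_ideal_eventually[OF assms(1)] by blast
  obtain n where n: "\<And>k. k \<ge> n \<Longrightarrow> k \<ge> degree h \<and> clear_denom d k h \<in> I"
    using inv_ideal_eventually[OF assms(2)] by blast
  show ?thesis
    unfolding inv_ideal_def using m[of "max m n"] n[of "max m n"]
    by (auto intro!: exI[of _ "max m n"] degree_add_le simp: clear_denom_add I_add)
qed

lemma inv_ideal_0 [simp]: "0 \<in> inv_ideal"
  by (simp add: inv_ideal_def clear_denom_def)

text \<open>By Horner's scheme it suffices to multiply by constants, which keep the exponent, and by \<open>t\<close>,
  which raises it by one.\<close>
lemma inv_ideal_mult:
  assumes "g \<in> polys" "h \<in> inv_ideal" shows "g * h \<in> inv_ideal"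
  using assms(1)
proof (induction g)
  case (pCons a g)
  have a: "a \<in> carrier (mpoly_ring X)" and g: "g \<in> polys"
    using pCons.prems by (auto simp: polys_def coeff_pCons split: nat.splits)
  obtain n where n: "degree h \<le> n" "clear_denom d n h \<in> I"
    using assms(2) by (auto simp: inv_ideal_def)
  have smult: "smult a h \<in> inv_ideal"
    unfolding inv_ideal_def using n a degree_smult_le[of a h]
    by (auto intro!: exI[of _ n] simp: clear_denom_smult I_mult)
  obtain m where m: "degree (g * h) \<le> m" "clear_denom d m (g * h) \<in> I"
    using pCons.IH[OF g] by (auto simp: inv_ideal_def)
  have "degree (pCons 0 (g * h)) \<le> Suc m"
    using degree_pCons_le[of 0 "g * h"] m(1) by linarith
  moreover have "clear_denom d (Suc m) (pCons 0 (g * h)) \<in> I"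
    using m(2) by (simp only: clear_denom_pCons_0)
  ultimately have "pCons 0 (g * h) \<in> inv_ideal"
    unfolding inv_ideal_def by blast
  with smult show ?case
    by (simp add: mult_pCons_left inv_ideal_add)
qed simp

lemma polys_const [simp]: "f \<in> carrier (mpoly_ring X) \<Longrightarrow> [:f:] \<in> polys"
  by (auto simp: polys_def coeff_pCons split: nat.split)

lemma polys_linear [simp]: "f \<in> carrier (mpoly_ring X) \<Longrightarrow> [:0, f:] \<in> polys"
  by (auto simp: polys_def coeff_pCons split: nat.split)

lemma polys_add [simp]: "g \<in> polys \<Longrightarrow> h \<in> polys \<Longrightarrow> g + h \<in> polys"
  by (auto simp: polys_def)

lemma polys_diff [simp]: "g \<in> polys \<Longrightarrow> h \<in> polys \<Longrightarrow> g - h \<in> polys"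
  by (auto simp: polys_def)

lemma polys_mult [simp]: "g \<in> polys \<Longrightarrow> h \<in> polys \<Longrightarrow> g * h \<in> polys"
  by (auto simp: polys_def coeff_mult)

lemma polys_1 [simp]: "1 \<in> polys"
  using polys_const[of 1] by (simp add: one_pCons)

lemma polys_prod [simp]: "(\<And>i. i \<in> A \<Longrightarrow> f i \<in> polys) \<Longrightarrow> (\<Prod>i\<in>A. f i) \<in> polys"
  by (induction A rule: infinite_finite_induct) auto

lemma polys_sum [simp]: "(\<And>i. i \<in> A \<Longrightarrow> f i \<in> polys) \<Longrightarrow> (\<Sum>i\<in>A. f i) \<in> polys"
  by (induction A rule: infinite_finite_induct) (auto simp: polys_def)

lemma inv_ideal_const: "f \<in> I \<Longrightarrow> [:f:] \<in> inv_ideal"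
  by (auto simp: inv_ideal_def clear_denom_const intro!: exI[of _ 0])

text \<open>This says \<open>t d \<equiv> 1\<close>.\<close>
lemma inv_ideal_unit: "[:- 1, d:] \<in> inv_ideal"
  by (auto simp: inv_ideal_def clear_denom_def intro!: exI[of _ 1])

text \<open>The way back from congruences to the ring without \<open>t\<close>: no polynomial free of \<open>t\<close> vanishes
  unless it is killed by a power of \<open>d\<close> modulo \<open>I\<close>.\<close>
lemma inv_ideal_constD:
  assumes "[:f:] \<in> inv_ideal" obtains n where "d ^ n * f \<in> I"
  using assms by (auto simp: inv_ideal_def clear_denom_const mult.commute)

lemma inv_ideal_uminus: "h \<in> inv_ideal \<Longrightarrow> - h \<in> inv_ideal"
  using inv_ideal_mult[of "[:- 1:]" h] by simp

lemma inv_ideal_diff: "g \<in> inv_ideal \<Longrightarrow> h \<in> inv_ideal \<Longrightarrow> g - h \<in> inv_ideal"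
  using inv_ideal_add[of g "- h"] inv_ideal_uminus by simp

lemma inv_ideal_sum: "(\<And>i. i \<in> A \<Longrightarrow> f i \<in> inv_ideal) \<Longrightarrow> (\<Sum>i\<in>A. f i) \<in> inv_ideal"
  by (induction A rule: infinite_finite_induct) (auto simp: inv_ideal_add)

lemma inv_ideal_mult_cong:
  assumes "f - f' \<in> inv_ideal" "g - g' \<in> inv_ideal" "f \<in> polys" "g' \<in> polys"
  shows "f * g - f' * g' \<in> inv_ideal"
proof -
  have "f * g - f' * g' = f * (g - g') + g' * (f - f')"
    by (simp add: algebra_simps)
  then show ?thesis
    using assms by (simp add: inv_ideal_add inv_ideal_mult)
qed

text \<open>Units modulo \<open>inv_ideal\<close> can be cancelled.\<close>
lemma inv_ideal_cancel:
  assumes "a * h \<in> inv_ideal" "b * a - 1 \<in> inv_ideal" "b \<in> polys" "h \<in> polys"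
  shows "h \<in> inv_ideal"
proof -
  have "h = b * (a * h) - h * (b * a - 1)"
    by (simp add: algebra_simps)
  then show ?thesis
    using assms by (metis inv_ideal_diff inv_ideal_mult)
qed

sublocale const: scalar_hom "\<lambda>a. [:mconst a:] :: 'x rpoly poly"
  by unfold_locales (simp_all add: one_pCons)

lemma poly_eval_polys:
  assumes "f \<in> carrier (mpoly_ring Y)" "\<And>y. y \<in> Y \<Longrightarrow> \<sigma> y \<in> polys"
  shows "poly_eval (\<lambda>a. [:mconst a:]) \<sigma> f \<in> polys"
  using assms(1) by (induction rule: mpoly_induct)
    (use assms(2) in \<open>auto simp: const.poly_eval_add const.poly_eval_mult\<close>)

lemma poly_eval_cong_inv_ideal:
  assumes "f \<in> carrier (mpoly_ring Y)" "\<And>y. y \<in> Y \<Longrightarrow> \<sigma> y \<in> polys" "\<And>y. y \<in> Y \<Longrightarrow> \<tau> y \<in> polys"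
    and "\<And>y. y \<in> Y \<Longrightarrow> \<sigma> y - \<tau> y \<in> inv_ideal"
  shows "poly_eval (\<lambda>a. [:mconst a:]) \<sigma> f - poly_eval (\<lambda>a. [:mconst a:]) \<tau> f \<in> inv_ideal"
  using assms(1)
proof (induction rule: mpoly_induct)
  case (add f g)
  then show ?case
    using inv_ideal_add[OF add.IH] by (simp add: const.poly_eval_add add_diff_add)
next
  case (mult f g)
  then show ?case
    by (auto simp: const.poly_eval_mult intro!: inv_ideal_mult_cong poly_eval_polys[of _ Y] assms(2,3))
qed (use assms(4) in auto)

lemma poly_eval_mvar_const: "poly_eval (\<lambda>a. [:mconst a:]) (\<lambda>y. [:mvar y:]) f = [:f :: 'x rpoly:]"
proof -
  have "f \<in> carrier (mpoly_ring UNIV)"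
    by (simp add: mpoly_carrier_iff)
  then show ?thesis
    by (induction rule: mpoly_induct)
      (auto simp: const.poly_eval_add const.poly_eval_mult)
qed

end


context inverting
begin

lemma quot_mult:
  assumes "f \<in> carrier (mpoly_ring X)" "g \<in> carrier (mpoly_ring X)"
  shows "(I +>\<^bsub>mpoly_ring X\<^esub> f) \<otimes>\<^bsub>mpoly_ring X Quot I\<^esub> (I +>\<^bsub>mpoly_ring X\<^esub> g) = I +>\<^bsub>mpoly_ring X\<^esub> f * g"
  using rcoset_mult_add[OF assms] by (simp add: FactRing_def)

lemma quot_pow:
  assumes "f \<in> carrier (mpoly_ring X)"
  shows "(I +>\<^bsub>mpoly_ring X\<^esub> f) [^]\<^bsub>mpoly_ring X Quot I\<^esub> (n::nat) = I +>\<^bsub>mpoly_ring X\<^esub> f ^ n"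
proof (induction n)
  case 0
  then show ?case by (simp add: FactRing_def)
next
  case (Suc n)
  then show ?case
    using assms by (simp add: quot_mult mult.commute)
qed

lemma quot_closed:
  "f \<in> carrier (mpoly_ring X) \<Longrightarrow> I +>\<^bsub>mpoly_ring X\<^esub> f \<in> carrier (mpoly_ring X Quot I)"
  by (auto simp: FactRing_def A_RCOSETS_def')

lemma localisation_quot: "localisation (mpoly_ring X Quot I) (I +>\<^bsub>mpoly_ring X\<^esub> d)"
  using quotient_is_cring[OF cring_mpoly_ring] quot_closed[OF d_closed]
  by (simp add: localisation_def localisation_axioms_def)

abbreviation frac :: "'x rpoly \<Rightarrow> nat \<Rightarrow> ('x rpoly set \<times> 'x rpoly set) set" where
  "frac f k \<equiv> loc_frac (mpoly_ring X Quot I) (I +>\<^bsub>mpoly_ring X\<^esub> d) (I +>\<^bsub>mpoly_ring X\<^esub> f)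
     ((I +>\<^bsub>mpoly_ring X\<^esub> d) [^]\<^bsub>mpoly_ring X Quot I\<^esub> k)"

lemma frac_closed:
  "f \<in> carrier (mpoly_ring X) \<Longrightarrow>
    frac f k \<in> carrier (localise (mpoly_ring X Quot I) (I +>\<^bsub>mpoly_ring X\<^esub> d))"
  by (rule localisation.loc_frac_closed[OF localisation_quot quot_closed
        localisation.powersI[OF localisation_quot]])

lemma frac_cases:
  assumes "Y \<in> carrier (localise (mpoly_ring X Quot I) (I +>\<^bsub>mpoly_ring X\<^esub> d))"
  obtains f k where "f \<in> carrier (mpoly_ring X)" "Y = frac f k"
  using localisation.loc_frac_cases[OF localisation_quot assms] quot_carrierE
    localisation.powersE[OF localisation_quot] by metis

text \<open>Equality of fractions, with cosets replaced by their representatives.\<close>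
lemma frac_eq_iff:
  assumes "f \<in> carrier (mpoly_ring X)" "g \<in> carrier (mpoly_ring X)"
  shows "frac f k = frac g l \<longleftrightarrow> (\<exists>m. d ^ m * (d ^ l * f - d ^ k * g) \<in> I)"
proof -
  interpret Q: localisation "mpoly_ring X Quot I" "I +>\<^bsub>mpoly_ring X\<^esub> d"
    by (rule localisation_quot)
  have "frac f k = frac g l \<longleftrightarrow>
      (\<exists>m. I +>\<^bsub>mpoly_ring X\<^esub> d ^ m * (d ^ l * f) = I +>\<^bsub>mpoly_ring X\<^esub> d ^ m * (d ^ k * g))"
    unfolding Q.loc_frac_eq_iff[OF quot_closed[OF assms(1)] quot_closed[OF assms(2)] Q.powersI Q.powersI]
    using assms by (simp add: Q.Bex_powers quot_pow quot_mult)
  then show ?thesis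
    using assms by (simp add: coset_eq_iff right_diff_distrib)
qed

end

section \<open>Paths of a probability tree\<close>

context probability_tree
begin

definition root_walk :: "'v \<Rightarrow> 'e list" where
  "root_walk v = (THE es. awalk r es v)"

lemma root_walk_unique: "awalk r es v \<Longrightarrow> es = root_walk v"
  unfolding root_walk_def
  using unique_awalk[of v] awalk_last_in_verts[of r es v] by (metis the1_equality)

lemma awalk_root_walk: "v \<in> verts T \<Longrightarrow> awalk r (root_walk v) v"
  unfolding root_walk_def by (rule theI') (rule unique_awalk)

lemma root_walk_root [simp]: "root_walk r = []"
  using root_walk_unique[of "[]" r] root_in_verts by (simp add: awalk_Nil_iff)

lemma root_walk_head:
  assumes "e \<in> arcs T"
  shows "root_walk (head T e) = root_walk (tail T e) @ [e]"
proof -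
  have "awalk r (root_walk (tail T e) @ [e]) (head T e)"
    using assms by (intro awalk_appendI[OF awalk_root_walk arc_implies_awalk]) auto
  then show ?thesis
    using root_walk_unique by metis
qed

text \<open>A repeated vertex on the walk would give a shorter walk to the same vertex, by cutting out the
  closed part between the repetitions. It matters because the model map multiplies labels over the
  set of edges of a path, which would forget repetitions.\<close>
lemma distinct_root_walk:
  assumes "v \<in> verts T" shows "distinct (root_walk v)"
proof (rule ccontr)
  have walk: "awalk r (root_walk v) v"
    using awalk_root_walk[OF assms] .
  assume "\<not> distinct (root_walk v)"
  then have "\<not> distinct (awalk_verts r (root_walk v))"
    using distinct_verts_imp_distinct[OF walk] by blast
  then obtain p q s w where "root_walk v = p @ q @ s" "0 < length q"
    and "awalk r p w" "awalk w s v"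
    using awalk_not_distinct_decomp[OF walk] by blast
  then show False
    using root_walk_unique[OF awalk_appendI, of p w s v] by simp
qed

lemma root_walk_arcs: "v \<in> verts T \<Longrightarrow> set (root_walk v) \<subseteq> arcs T"
  using awalk_root_walk by blast

lemma root_walk_length: "v \<in> verts T \<Longrightarrow> length (root_walk v) \<le> card (arcs T)"
  using distinct_card[OF distinct_root_walk, of v] card_mono[OF finite_arcs root_walk_arcs, of v]
  by simp

text \<open>The parts below \<open>v\<close> of the paths through \<open>v\<close>. Unlike the paths themselves they have an
  immediate recursion over the outgoing edges.\<close>
definition leaf_walks :: "'v \<Rightarrow> 'e list set" where
  "leaf_walks v = {q. \<exists>l\<in>verts T. out_arcs T l = {} \<and> awalk v q l}"

lemma leaf_walks_leaf:
  assumes "v \<in> verts T" "out_arcs T v = {}" shows "leaf_walks v = {[]}"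
proof -
  have "q = []" if "awalk v q l" for q l
    using that assms(2) by (cases q) (auto simp: awalk_Cons_iff out_arcs_def)
  then show ?thesis
    using assms by (auto simp: leaf_walks_def awalk_Nil_iff)
qed

lemma leaf_walks_internal:
  assumes "out_arcs T v \<noteq> {}"
  shows "leaf_walks v = (\<Union>e\<in>out_arcs T v. (#) e ` leaf_walks (head T e))"
proof (intro equalityI subsetI)
  fix q assume "q \<in> leaf_walks v"
  then obtain l where l: "l \<in> verts T" "out_arcs T l = {}" "awalk v q l"
    by (auto simp: leaf_walks_def)
  then obtain e q' where "q = e # q'"
    using assms by (cases q) (auto simp: awalk_Nil_iff)
  then show "q \<in> (\<Union>e\<in>out_arcs T v. (#) e ` leaf_walks (head T e))"
    using l by (auto simp: awalk_Cons_iff leaf_walks_def intro!: bexI[of _ e])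
qed (auto simp: leaf_walks_def awalk_Cons_iff)

lemma paths_through_eq:
  assumes "v \<in> verts T"
  shows "paths_through T r v = (\<lambda>q. root_walk v @ q) ` leaf_walks v"
proof (intro equalityI subsetI)
  fix es assume "es \<in> paths_through T r v"
  then obtain l where l: "l \<in> verts T" "out_arcs T l = {}" "awalk r es l" "v \<in> set (awalk_verts r es)"
    by (auto simp: paths_through_def paths_def)
  then obtain p q where "es = p @ q" "awalk r p v" "awalk v q l"
    using awalk_decomp by blast
  then show "es \<in> (\<lambda>q. root_walk v @ q) ` leaf_walks v"
    using l root_walk_unique by (auto simp: leaf_walks_def)
next
  fix es assume "es \<in> (\<lambda>q. root_walk v @ q) ` leaf_walks v"
  then obtain q l where q: "es = root_walk v @ q" "l \<in> verts T" "out_arcs T l = {}" "awalk v q l"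
    by (auto simp: leaf_walks_def)
  note walk = awalk_root_walk[OF assms]
  have "awalk r es l"
    using q awalk_appendI[OF walk] by simp
  moreover have "v \<in> set (awalk_verts r es)"
    using set_awalk_verts_append[OF walk q(4)] hd_in_awalk_verts(1)[OF q(4)] q(1) by simp
  ultimately show "es \<in> paths_through T r v"
    using q by (auto simp: paths_through_def paths_def)
qed

lemma paths_through_leaf:
  "v \<in> verts T \<Longrightarrow> out_arcs T v = {} \<Longrightarrow> paths_through T r v = {root_walk v}"
  by (simp add: paths_through_eq leaf_walks_leaf)

lemma paths_through_internal:
  assumes "v \<in> verts T" "out_arcs T v \<noteq> {}"
  shows "paths_through T r v = (\<Union>e\<in>out_arcs T v. paths_through T r (head T e))"
  using assms by (auto simp: paths_through_eq leaf_walks_internal root_walk_head image_UN image_image)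

lemma paths_through_disjoint:
  assumes "e \<in> out_arcs T v" "f \<in> out_arcs T v" "e \<noteq> f"
  shows "paths_through T r (head T e) \<inter> paths_through T r (head T f) = {}"
  using assms by (auto simp: paths_through_eq root_walk_head)

lemma paths_eq_leaves: "paths T r = root_walk ` {l \<in> verts T. out_arcs T l = {}}"
  using awalk_root_walk root_walk_unique by (auto simp: paths_def)

lemma finite_paths: "finite (paths T r)"
  by (simp add: paths_eq_leaves)

lemma finite_paths_through: "finite (paths_through T r v)"
  by (rule finite_subset[OF _ finite_paths]) (auto simp: paths_through_def)

lemma paths_through_root: "paths_through T r r = paths T r"
  using root_in_verts by (auto simp: paths_through_def paths_def intro: hd_in_awalk_verts)

lemma p_vertex_leaf:
  "v \<in> verts T \<Longrightarrow> out_arcs T v = {} \<Longrightarrow> p_vertex T r v = mvar (root_walk v)"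
  by (simp add: p_vertex_def paths_through_leaf)

text \<open>A path through an inner vertex continues along exactly one of its edges.\<close>
lemma p_vertex_internal:
  assumes "v \<in> verts T" "out_arcs T v \<noteq> {}"
  shows "p_vertex T r v = (\<Sum>e\<in>out_arcs T v. p_vertex T r (head T e))"
  unfolding p_vertex_def paths_through_internal[OF assms]
  using finite_paths_through paths_through_disjoint
  by (intro sum.UNION_disjoint) auto

lemma p_vertex_closed [simp]: "p_vertex T r v \<in> carrier (mpoly_ring (paths T r))"
  unfolding p_vertex_def by (intro mpoly_sum_closed mpoly_var_closed) (auto simp: paths_through_def)

lemma homogeneous_p_vertex: "homogeneous 1 (p_vertex T r v)"
  unfolding p_vertex_def by (intro homogeneous_sum homogeneous_mvar)

definition internals :: "'v set" where
  "internals = {v \<in> verts T. out_arcs T v \<noteq> {}}"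

lemma finite_internals [simp]: "finite internals"
  by (simp add: internals_def)

lemma tail_internal [simp]: "e \<in> arcs T \<Longrightarrow> tail T e \<in> internals"
  by (auto simp: internals_def)

lemma denominators_eq: "denominators T r = (\<Prod>v\<in>internals. p_vertex T r v)"
  by (simp add: denominators_def internals_def)

lemma denominators_closed [simp]: "denominators T r \<in> carrier (mpoly_ring (paths T r))"
  unfolding denominators_eq by (intro mpoly_prod_closed p_vertex_closed)

lemma homogeneous_denominators: "homogeneous (card internals) (denominators T r)"
  unfolding denominators_eq by (intro homogeneous_prod homogeneous_p_vertex)

text \<open>With \<open>t\<close> in the role of \<open>1 / denominators T r\<close>, the element \<open>cofactor v * t\<close> is the inverse of
  \<open>p_vertex T r v\<close>.\<close>
definition cofactor :: "'v \<Rightarrow> 'e list rpoly" where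
  "cofactor v = (\<Prod>w\<in>internals - {v}. p_vertex T r w)"

lemma cofactor_closed [simp]: "cofactor v \<in> carrier (mpoly_ring (paths T r))"
  unfolding cofactor_def by (intro mpoly_prod_closed p_vertex_closed)

lemma p_vertex_cofactor: "v \<in> internals \<Longrightarrow> p_vertex T r v * cofactor v = denominators T r"
  unfolding cofactor_def denominators_eq by (simp add: prod.remove[symmetric])

lemma homogeneous_p_vertex_cofactor:
  assumes "w \<in> internals" shows "homogeneous (card internals) (p_vertex T r v * cofactor w)"
proof -
  have "homogeneous (card (internals - {w})) (cofactor w)"
    unfolding cofactor_def by (intro homogeneous_prod homogeneous_p_vertex)
  then have "homogeneous (1 + card (internals - {w})) (p_vertex T r v * cofactor w)"
    by (intro homogeneous_mult homogeneous_p_vertex)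
  moreover have "1 + card (internals - {w}) = card internals"
    using assms card.remove[OF finite_internals assms] by simp
  ultimately show ?thesis by simp
qed

lemma vertex_induct [consumes 1, case_names root head]:
  assumes "v \<in> verts T" and "P r" and "\<And>e. e \<in> arcs T \<Longrightarrow> P (tail T e) \<Longrightarrow> P (head T e)"
  shows "P v"
  using assms(1)
proof (induction "length (root_walk v)" arbitrary: v rule: less_induct)
  case less
  show ?case
  proof (cases "root_walk v" rule: rev_cases)
    case Nil
    then show ?thesis
      using awalk_root_walk[OF less.prems] assms(2) by (simp add: awalk_Nil_iff)
  next
    case (snoc es e)
    then have e: "e \<in> arcs T" "head T e = v"
      using awalk_root_walk[OF less.prems] by (auto simp: awalk_simps)
    then show ?thesis
      using less.hyps[of "tail T e"] assms(3)[OF e(1)] root_walk_head[OF e(1)] by simp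
  qed
qed

text \<open>Induction from the leaves upwards. It terminates since root walks have distinct edges, so their
  length is bounded by the number of edges.\<close>
lemma vertex_leaf_induct [consumes 1, case_names leaf internal]:
  assumes "v \<in> verts T" and "\<And>v. v \<in> verts T \<Longrightarrow> out_arcs T v = {} \<Longrightarrow> P v"
    and "\<And>v. v \<in> verts T \<Longrightarrow> out_arcs T v \<noteq> {} \<Longrightarrow> (\<And>e. e \<in> out_arcs T v \<Longrightarrow> P (head T e)) \<Longrightarrow> P v"
  shows "P v"
  using assms(1)
proof (induction "card (arcs T) - length (root_walk v)" arbitrary: v rule: less_induct)
  case less
  have "P (head T e)" if "e \<in> out_arcs T v" for e
    using that root_walk_head[of e] root_walk_length[of "head T e"] by (intro less.hyps) auto
  then show ?case
    using assms(2,3) less.prems by blast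
qed

end

section \<open>The model map and its kernel\<close>

context staged_tree
begin

abbreviation cls :: "'e \<Rightarrow> 'e set" where
  "cls \<equiv> edge_class T \<theta> stage"

abbreviation label :: "'e \<Rightarrow> 'e set rpoly" where
  "label e \<equiv> mvar (cls e)"

abbreviation label_subst :: "'e list rpoly \<Rightarrow> 'e set rpoly" where
  "label_subst \<equiv> msubst (\<lambda>es. \<Prod>e\<in>set es. label e)"

lemma edge_class_self: "e \<in> arcs T \<Longrightarrow> e \<in> cls e"
  using equiv_stage by (auto simp: edge_class_def equiv_def refl_on_def)

lemma edge_class_eq:
  assumes "(tail T e, tail T f) \<in> stage" "\<theta> e = \<theta> f" shows "cls e = cls f"
  using assms equiv_stage unfolding edge_class_def equiv_def
  by (auto dest: symD transD)

lemma label_closed [simp]: "e \<in> arcs T \<Longrightarrow> label e \<in> carrier (mpoly_ring (cls ` arcs T))"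
  by simp

lemma sum_labels_closed:
  "(\<Sum>e\<in>out_arcs T v. label e) - 1 \<in> carrier (mpoly_ring (cls ` arcs T))"
  by (intro mpoly_diff_closed mpoly_sum_closed label_closed mpoly_1_closed) simp

lemma label_ideal: "mpoly_ideal (sum_to_one_ideal T \<theta> stage) (cls ` arcs T)"
  unfolding sum_to_one_ideal_def label_ring_def by (rule mpoly_ideal_genideal) (use sum_labels_closed in blast)

sublocale L: mpoly_ideal "sum_to_one_ideal T \<theta> stage" "cls ` arcs T"
  by (rule label_ideal)

lemma sum_labels:
  assumes "v \<in> verts T" "out_arcs T v \<noteq> {}"
  shows "(\<Sum>e\<in>out_arcs T v. label e) - 1 \<in> sum_to_one_ideal T \<theta> stage"
  unfolding sum_to_one_ideal_def label_ring_def
  by (rule subsetD[OF mpoly_genideal_self]) (use assms sum_labels_closed in blast)+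

lemma prod_labels_closed:
  "set es \<subseteq> arcs T \<Longrightarrow> (\<Prod>e\<in>set es. label e) \<in> carrier (mpoly_ring (cls ` arcs T))"
  by (intro mpoly_prod_closed label_closed) auto

lemma paths_arcs: "es \<in> paths T r \<Longrightarrow> set es \<subseteq> arcs T"
  using root_walk_arcs by (auto simp: paths_eq_leaves)

lemma label_subst_closed:
  assumes "f \<in> carrier (mpoly_ring (paths T r))"
  shows "label_subst f \<in> carrier (mpoly_ring (cls ` arcs T))"
  using assms unfolding msubst_eq_poly_eval
  by (induction rule: mpoly_induct)
    (simp_all add: mconst.poly_eval_add mconst.poly_eval_mult prod_labels_closed paths_arcs)

lemmas label_subst_simps =
  mconst.poly_eval_add[of "\<lambda>es. \<Prod>e\<in>set es. label e", folded msubst_eq_poly_eval]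
  mconst.poly_eval_diff[of "\<lambda>es. \<Prod>e\<in>set es. label e", folded msubst_eq_poly_eval]
  mconst.poly_eval_mult[of "\<lambda>es. \<Prod>e\<in>set es. label e", folded msubst_eq_poly_eval]
  mconst.poly_eval_power[of "\<lambda>es. \<Prod>e\<in>set es. label e", folded msubst_eq_poly_eval]
  mconst.poly_eval_sum[of "\<lambda>es. \<Prod>e\<in>set es. label e", folded msubst_eq_poly_eval]
  mconst.poly_eval_mvar[of "\<lambda>es. \<Prod>e\<in>set es. label e", folded msubst_eq_poly_eval]
  mconst.poly_eval_mconst[of "\<lambda>es. \<Prod>e\<in>set es. label e", folded msubst_eq_poly_eval]
  mconst.poly_eval_0[of "\<lambda>es. \<Prod>e\<in>set es. label e", folded msubst_eq_poly_eval]
  mconst.poly_eval_1[of "\<lambda>es. \<Prod>e\<in>set es. label e", folded msubst_eq_poly_eval]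

text \<open>At a leaf this is the definition of the model map. At an inner vertex the products for the
  children share the factor \<open>?w\<close>, and the remaining labels sum to one.\<close>
lemma label_subst_p_vertex:
  assumes "v \<in> verts T"
  shows "label_subst (p_vertex T r v) - (\<Prod>e\<in>set (root_walk v). label e) \<in> sum_to_one_ideal T \<theta> stage"
  using assms
proof (induction rule: vertex_leaf_induct)
  case (leaf v)
  then show ?case by (simp add: p_vertex_leaf label_subst_simps)
next
  case (internal v)
  let ?w = "\<Prod>e\<in>set (root_walk v). label e"
  have "(\<Prod>f\<in>set (root_walk (head T e)). label f) = ?w * label e" if "e \<in> out_arcs T v" for e
    using that distinct_root_walk[of "head T e"] root_walk_head[of e] by (auto simp: mult.commute)
  then have "(\<Sum>e\<in>out_arcs T v. label_subst (p_vertex T r (head T e)) - ?w * label e)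
      \<in> sum_to_one_ideal T \<theta> stage"
    using internal.IH by (intro L.I_sum) simp
  moreover have "?w * ((\<Sum>e\<in>out_arcs T v. label e) - 1) \<in> sum_to_one_ideal T \<theta> stage"
    using sum_labels internal.hyps root_walk_arcs by (intro L.I_mult prod_labels_closed) auto
  ultimately have "(\<Sum>e\<in>out_arcs T v. label_subst (p_vertex T r (head T e)) - ?w * label e)
      + ?w * ((\<Sum>e\<in>out_arcs T v. label e) - 1) \<in> sum_to_one_ideal T \<theta> stage"
    by (rule L.I_add)
  also have "(\<Sum>e\<in>out_arcs T v. label_subst (p_vertex T r (head T e)) - ?w * label e)
      + ?w * ((\<Sum>e\<in>out_arcs T v. label e) - 1) = label_subst (p_vertex T r v) - ?w"
    using internal.hyps
    by (simp add: p_vertex_internal label_subst_simps sum_subtractf sum_distrib_left right_diff_distrib)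
  finally show ?case .
qed

lemma label_subst_root: "label_subst (p_vertex T r r) - 1 \<in> sum_to_one_ideal T \<theta> stage"
  using label_subst_p_vertex[OF root_in_verts] by simp

text \<open>Up to clearing the denominator, the label is the conditional probability of its edge. Together
  with \<open>label_subst_root\<close> this yields both the elements of the kernel and preimages of the labels.\<close>
lemma label_subst_head:
  assumes "e \<in> arcs T"
  shows "label_subst (p_vertex T r (head T e)) - label e * label_subst (p_vertex T r (tail T e))
    \<in> sum_to_one_ideal T \<theta> stage"
proof -
  let ?w = "\<Prod>f\<in>set (root_walk (tail T e)). label f"
  have "(\<Prod>f\<in>set (root_walk (head T e)). label f) = label e * ?w"
    using assms distinct_root_walk[of "head T e"] root_walk_head[of e] by auto
  then have "label_subst (p_vertex T r (head T e)) - label e * ?w \<in> sum_to_one_ideal T \<theta> stage"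
    using label_subst_p_vertex[of "head T e"] assms by simp
  moreover have "label e * (label_subst (p_vertex T r (tail T e)) - ?w) \<in> sum_to_one_ideal T \<theta> stage"
    using label_subst_p_vertex[of "tail T e"] assms by (intro L.I_mult) auto
  ultimately have "(label_subst (p_vertex T r (head T e)) - label e * ?w)
      - label e * (label_subst (p_vertex T r (tail T e)) - ?w) \<in> sum_to_one_ideal T \<theta> stage"
    by (rule L.I_diff)
  then show ?thesis
    by (simp add: right_diff_distrib)
qed

lemma model_map_eq: "model_map T \<theta> stage f =
    sum_to_one_ideal T \<theta> stage +>\<^bsub>mpoly_ring (cls ` arcs T)\<^esub> label_subst f"
  by (simp add: model_map_def label_ring_def)

lemma label_quot_cring: "cring (label_quot T \<theta> stage)"
  using L.quotient_is_cring[OF cring_mpoly_ring] by (simp add: label_quot_def label_ring_def)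

lemma model_map_hom: "model_map T \<theta> stage \<in> ring_hom (prob_ring T r) (label_quot T \<theta> stage)"
proof -
  have "label_subst \<in> ring_hom (mpoly_ring (paths T r)) (mpoly_ring (cls ` arcs T))"
    by (rule ring_hom_memI) (simp_all add: label_subst_closed label_subst_simps)
  then have "(\<lambda>g. sum_to_one_ideal T \<theta> stage +>\<^bsub>mpoly_ring (cls ` arcs T)\<^esub> g) \<circ> label_subst
      \<in> ring_hom (prob_ring T r) (label_quot T \<theta> stage)"
    using L.rcos_ring_hom unfolding label_quot_def label_ring_def prob_ring_def
    by (rule ring_hom_trans)
  moreover have "model_map T \<theta> stage =
      (\<lambda>g. sum_to_one_ideal T \<theta> stage +>\<^bsub>mpoly_ring (cls ` arcs T)\<^esub> g) \<circ> label_subst"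
    by (simp add: fun_eq_iff model_map_eq)
  ultimately show ?thesis
    by simp
qed

lemma model_ker_eq:
  "model_ker T r \<theta> stage =
    {f \<in> carrier (mpoly_ring (paths T r)). label_subst f \<in> sum_to_one_ideal T \<theta> stage}"
proof -
  have "(model_map T \<theta> stage f = \<zero>\<^bsub>label_quot T \<theta> stage\<^esub>) \<longleftrightarrow> label_subst f \<in> sum_to_one_ideal T \<theta> stage"
    if "f \<in> carrier (mpoly_ring (paths T r))" for f
  proof -
    have "\<zero>\<^bsub>label_quot T \<theta> stage\<^esub> = sum_to_one_ideal T \<theta> stage +>\<^bsub>mpoly_ring (cls ` arcs T)\<^esub> 0"
      using L.a_rcos_const[of 0] by (simp add: label_quot_def label_ring_def FactRing_def)
    then show ?thesis
      using that L.coset_eq_iff[of "label_subst f" 0] by (simp add: model_map_eq label_subst_closed)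
  qed
  then show ?thesis
    by (auto simp: model_ker_def a_kernel_def' prob_ring_def)
qed

lemma model_ker_ideal: "mpoly_ideal (model_ker T r \<theta> stage) (paths T r)"
  unfolding model_ker_eq
  by (rule mpoly_idealI)
    (auto simp: label_subst_simps intro: L.I_add L.I_mult label_subst_closed)

text \<open>The generating set of \<open>invariant_ideal\<close>, named because its elements, unlike those of the ideal,
  are all homogeneous.\<close>
definition invariants :: "'e list rpoly set" where
  "invariants = {p_vertex T r (tail T e) * p_vertex T r (head T f)
        - p_vertex T r (head T e) * p_vertex T r (tail T f) | e f.
        e \<in> arcs T \<and> f \<in> arcs T \<and> (tail T e, tail T f) \<in> stage \<and> \<theta> e = \<theta> f}"

lemma invariants_closed: "invariants \<subseteq> carrier (mpoly_ring (paths T r))"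
  by (auto simp: invariants_def)

lemma invariant_ideal_eq: "invariant_ideal T r \<theta> stage = Idl\<^bsub>mpoly_ring (paths T r)\<^esub> invariants"
  by (simp add: invariant_ideal_def invariants_def prob_ring_def)

lemma invariant_ideal: "mpoly_ideal (invariant_ideal T r \<theta> stage) (paths T r)"
  unfolding invariant_ideal_eq by (rule mpoly_ideal_genideal[OF invariants_closed])

lemma invariants_subset: "invariants \<subseteq> invariant_ideal T r \<theta> stage"
  unfolding invariant_ideal_eq by (rule mpoly_genideal_self[OF invariants_closed])

lemma invariants_homogeneous: "g \<in> invariants \<Longrightarrow> homogeneous 2 g"
  unfolding invariants_def
  using homogeneous_mult[OF homogeneous_p_vertex homogeneous_p_vertex]
  by (auto intro!: homogeneous_diff simp: numeral_2_eq_2)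

text \<open>With \<open>e = (v, v')\<close> and \<open>f = (w, w')\<close> in the same class with indeterminate \<open>x\<close>, both products of
  the invariant are congruent to \<open>x\<close> times the images of \<open>p\<^sub>v\<close> and \<open>p\<^sub>w\<close>.\<close>
lemma invariants_ker: "invariants \<subseteq> model_ker T r \<theta> stage"
proof
  fix g assume g: "g \<in> invariants"
  then obtain e f where ef: "e \<in> arcs T" "f \<in> arcs T" "(tail T e, tail T f) \<in> stage" "\<theta> e = \<theta> f"
    and g_eq: "g = p_vertex T r (tail T e) * p_vertex T r (head T f)
        - p_vertex T r (head T e) * p_vertex T r (tail T f)"
    by (auto simp: invariants_def)
  let ?p = "\<lambda>v. label_subst (p_vertex T r v)"
  have [simp]: "?p v \<in> carrier (mpoly_ring (cls ` arcs T))" for v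
    by (simp add: label_subst_closed)
  have "label_subst g = ?p (tail T e) * (?p (head T f) - label e * ?p (tail T f))
      - ?p (tail T f) * (?p (head T e) - label e * ?p (tail T e))"
    by (simp add: g_eq label_subst_simps algebra_simps)
  also have "\<dots> \<in> sum_to_one_ideal T \<theta> stage"
    using label_subst_head[OF ef(1)] label_subst_head[OF ef(2)] edge_class_eq[OF ef(3,4)]
    by (intro L.I_diff[OF L.I_mult L.I_mult]) simp_all
  finally show "g \<in> model_ker T r \<theta> stage"
    using g invariants_closed by (auto simp: model_ker_eq)
qed

lemma invariant_ideal_ker: "invariant_ideal T r \<theta> stage \<subseteq> model_ker T r \<theta> stage"
  unfolding invariant_ideal_eq by (rule mpoly_genideal_minimal[OF model_ker_ideal invariants_ker])

lemma affine_gens_closed: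
  "invariant_ideal T r \<theta> stage \<union> {p_vertex T r r - 1} \<subseteq> carrier (mpoly_ring (paths T r))"
  using mpoly_ideal.I_carrier[OF invariant_ideal] by auto

lemma affine_invariant_ideal_eq:
  "affine_invariant_ideal T r \<theta> stage =
    Idl\<^bsub>mpoly_ring (paths T r)\<^esub> (invariant_ideal T r \<theta> stage \<union> {p_vertex T r r - 1})"
  by (simp add: affine_invariant_ideal_def prob_ring_def p_vertex_def paths_through_root)

lemma affine_invariant_ideal: "mpoly_ideal (affine_invariant_ideal T r \<theta> stage) (paths T r)"
  unfolding affine_invariant_ideal_eq by (rule mpoly_ideal_genideal[OF affine_gens_closed])

lemma affine_invariant_ideal_supset:
  "invariant_ideal T r \<theta> stage \<subseteq> affine_invariant_ideal T r \<theta> stage"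
  "p_vertex T r r - 1 \<in> affine_invariant_ideal T r \<theta> stage"
  using mpoly_genideal_self[OF affine_gens_closed] unfolding affine_invariant_ideal_eq by auto

lemma affine_invariant_ideal_ker: "affine_invariant_ideal T r \<theta> stage \<subseteq> model_ker T r \<theta> stage"
  unfolding affine_invariant_ideal_eq
  by (rule mpoly_genideal_minimal[OF model_ker_ideal])
    (use invariant_ideal_ker label_subst_root in \<open>auto simp: model_ker_eq label_subst_simps\<close>)

text \<open>Surjectivity without fractions: every \<open>g\<close> becomes an image after multiplication with a power of
  \<open>\<phi>(d)\<close>. The degree of the preimage is recorded because it must match that of \<open>d ^ k\<close> for the
  fraction to have degree zero.\<close>
lemma label_fraction:
  assumes "g \<in> carrier (mpoly_ring (cls ` arcs T))"
  shows "\<exists>k f. f \<in> carrier (mpoly_ring (paths T r)) \<and> homogeneous (k * card internals) f \<and>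
    label_subst f - label_subst (denominators T r) ^ k * g \<in> sum_to_one_ideal T \<theta> stage"
  using assms
proof (induction rule: mpoly_induct)
  case (const a)
  show ?case
    by (rule exI[of _ 0], rule exI[of _ "mconst a"])
      (simp add: homogeneous_mconst label_subst_simps)
next
  case (var E)
  then obtain e where e: "e \<in> arcs T" "E = cls e" by auto
  let ?p = "\<lambda>v. label_subst (p_vertex T r v)"
  \<comment> \<open>the label is \<open>p\<^sub>w / p\<^sub>v\<close>, expanded to the common denominator \<open>d\<close>\<close>
  let ?c = "label_subst (cofactor (tail T e))"
  have "?c * (?p (head T e) - label e * ?p (tail T e)) \<in> sum_to_one_ideal T \<theta> stage"
    using label_subst_head[OF e(1)] by (intro L.I_mult) (auto simp: label_subst_closed)
  then have "label_subst (p_vertex T r (head T e) * cofactor (tail T e))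
      - label_subst (denominators T r) ^ 1 * label e \<in> sum_to_one_ideal T \<theta> stage"
    using p_vertex_cofactor[OF tail_internal[OF e(1)], symmetric]
    by (simp add: label_subst_simps algebra_simps)
  then show ?case
    using homogeneous_p_vertex_cofactor[OF tail_internal[OF e(1)]] e
    by (intro exI[of _ 1] exI[of _ "p_vertex T r (head T e) * cofactor (tail T e)"]) simp
next
  case (add g h)
  let ?d = "denominators T r" and ?D = "label_subst (denominators T r)"
  from add obtain k a l b where
    a: "a \<in> carrier (mpoly_ring (paths T r))" "homogeneous (k * card internals) a"
      "label_subst a - ?D ^ k * g \<in> sum_to_one_ideal T \<theta> stage" and
    b: "b \<in> carrier (mpoly_ring (paths T r))" "homogeneous (l * card internals) b"
      "label_subst b - ?D ^ l * h \<in> sum_to_one_ideal T \<theta> stage"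
    by blast
  have "homogeneous ((k + l) * card internals) (?d ^ l * a + ?d ^ k * b)"
    using homogeneous_mult[OF homogeneous_power[OF homogeneous_denominators, of l] a(2)]
      homogeneous_mult[OF homogeneous_power[OF homogeneous_denominators, of k] b(2)]
    by (intro homogeneous_add) (simp_all add: algebra_simps)
  moreover have "?D ^ l * (label_subst a - ?D ^ k * g) + ?D ^ k * (label_subst b - ?D ^ l * h)
      \<in> sum_to_one_ideal T \<theta> stage"
    using a b by (intro L.I_add L.I_mult) (auto simp: label_subst_closed)
  then have "label_subst (?d ^ l * a + ?d ^ k * b) - ?D ^ (k + l) * (g + h) \<in> sum_to_one_ideal T \<theta> stage"
    by (simp add: label_subst_simps algebra_simps power_add)
  ultimately show ?case
    using a(1) b(1) by (intro exI[of _ "k + l"] exI[of _ "?d ^ l * a + ?d ^ k * b"]) simp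
next
  case (mult g h)
  let ?D = "label_subst (denominators T r)"
  from mult obtain k a l b where
    a: "a \<in> carrier (mpoly_ring (paths T r))" "homogeneous (k * card internals) a"
      "label_subst a - ?D ^ k * g \<in> sum_to_one_ideal T \<theta> stage" and
    b: "b \<in> carrier (mpoly_ring (paths T r))" "homogeneous (l * card internals) b"
      "label_subst b - ?D ^ l * h \<in> sum_to_one_ideal T \<theta> stage"
    by blast
  have "label_subst b * (label_subst a - ?D ^ k * g) + (?D ^ k * g) * (label_subst b - ?D ^ l * h)
      \<in> sum_to_one_ideal T \<theta> stage"
    using a b mult by (intro L.I_add L.I_mult) (auto simp: label_subst_closed)
  then have "label_subst (a * b) - ?D ^ (k + l) * (g * h) \<in> sum_to_one_ideal T \<theta> stage"
    by (simp add: label_subst_simps algebra_simps power_add)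
  then show ?case
    using a b homogeneous_mult[OF a(2) b(2)]
    by (intro exI[of _ "k + l"] exI[of _ "a * b"]) (simp add: algebra_simps)
qed

end

section \<open>The inverse substitution\<close>

text \<open>The ideal is left open, since the construction serves both the ideal of invariants and the one
  enlarged by \<open>p\<^sub>r - 1\<close>.\<close>
locale inverse_model_map = staged_tree T r \<theta> stage + inverting I "paths T r" "denominators T r"
  for T :: "('v, 'e) pre_digraph" and r :: 'v and \<theta> :: "'e \<Rightarrow> real" and stage :: "'v rel"
    and I :: "'e list rpoly set" +
  assumes invariants_I: "invariants \<subseteq> I"
begin

text \<open>This is \<open>p\<^sub>w / p\<^sub>v\<close> for an edge \<open>(v, w)\<close> picked from the class, as \<open>p\<^sub>w\<close> times the inverse
  \<open>cofactor v * t\<close> of \<open>p\<^sub>v\<close>.\<close>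
definition inverse_label :: "'e set \<Rightarrow> 'e list rpoly poly" where
  "inverse_label E = (let e = (SOME e. e \<in> E) in [:0, p_vertex T r (head T e) * cofactor (tail T e):])"

definition inverse_map :: "'e set rpoly \<Rightarrow> 'e list rpoly poly" where
  "inverse_map = poly_eval (\<lambda>a. [:mconst a:]) inverse_label"

lemma inverse_label_polys [simp]: "inverse_label E \<in> polys"
  by (simp add: inverse_label_def Let_def)

lemma p_vertex_unit:
  assumes "v \<in> internals"
  shows "[:0, cofactor v:] * [:p_vertex T r v:] - 1 \<in> inv_ideal"
proof -
  have "[:0, cofactor v:] * [:p_vertex T r v:] - 1 = [:- 1, denominators T r:]"
    using p_vertex_cofactor[OF assms] by (simp add: one_pCons mult.commute)
  then show ?thesis
    using inv_ideal_unit by simp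
qed

text \<open>For the edge \<open>f\<close> picked from the class of \<open>e\<close>, the invariant of the pair \<open>e\<close>, \<open>f\<close> turns the
  quotient for \<open>f\<close> into the one for \<open>e\<close>.\<close>
lemma inverse_label_cong:
  assumes "e \<in> arcs T"
  shows "[:p_vertex T r (tail T e):] * inverse_label (cls e) - [:p_vertex T r (head T e):] \<in> inv_ideal"
proof -
  define f where "f = (SOME f. f \<in> cls e)"
  have "f \<in> cls e"
    unfolding f_def using edge_class_self[OF assms] by (rule someI)
  then have f: "f \<in> arcs T" "(tail T e, tail T f) \<in> stage" "\<theta> e = \<theta> f"
    by (auto simp: edge_class_def)
  let ?p = "p_vertex T r"
  let ?g = "?p (tail T e) * ?p (head T f) - ?p (head T e) * ?p (tail T f)"
  have "?g \<in> I"
    using assms f invariants_I by (auto simp: invariants_def)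
  then have "[:0, cofactor (tail T f):] * [:?g:] \<in> inv_ideal"
    by (intro inv_ideal_mult inv_ideal_const polys_linear) simp
  moreover have "[:?p (head T e):] * ([:0, cofactor (tail T f):] * [:?p (tail T f):] - 1) \<in> inv_ideal"
    using p_vertex_unit[OF tail_internal[OF f(1)]] by (intro inv_ideal_mult polys_const) simp_all
  ultimately have "[:0, cofactor (tail T f):] * [:?g:]
      + [:?p (head T e):] * ([:0, cofactor (tail T f):] * [:?p (tail T f):] - 1) \<in> inv_ideal"
    by (rule inv_ideal_add)
  also have "[:0, cofactor (tail T f):] * [:?g:]
      + [:?p (head T e):] * ([:0, cofactor (tail T f):] * [:?p (tail T f):] - 1)
      = [:?p (tail T e):] * inverse_label (cls e) - [:?p (head T e):]"
    by (simp add: inverse_label_def Let_def f_def[symmetric] one_pCons algebra_simps)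
  finally show ?thesis .
qed

text \<open>Multiplied by the unit \<open>p\<^sub>v\<close>, the sum-to-one relation becomes the decomposition of \<open>p\<^sub>v\<close>
  into the \<open>p\<^sub>w\<close> of its children.\<close>
lemma inverse_label_sum:
  assumes "v \<in> verts T" "out_arcs T v \<noteq> {}"
  shows "(\<Sum>e\<in>out_arcs T v. inverse_label (cls e)) - 1 \<in> inv_ideal"
proof (rule inv_ideal_cancel)
  have const_sum: "[:\<Sum>e\<in>A. h e:] = (\<Sum>e\<in>A. [:h e:])" for A and h :: "'e \<Rightarrow> 'e list rpoly"
  proof (induction A rule: infinite_finite_induct)
    case (insert e A)
    have "[:h e + (\<Sum>e\<in>A. h e):] = [:h e:] + [:\<Sum>e\<in>A. h e:]"
      by simp
    then show ?case
      using insert by simp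
  qed auto
  have "(\<Sum>e\<in>out_arcs T v. [:p_vertex T r (tail T e):] * inverse_label (cls e)
      - [:p_vertex T r (head T e):]) \<in> inv_ideal"
    by (intro inv_ideal_sum inverse_label_cong) simp
  also have "(\<Sum>e\<in>out_arcs T v. [:p_vertex T r (tail T e):] * inverse_label (cls e)
      - [:p_vertex T r (head T e):])
      = (\<Sum>e\<in>out_arcs T v. [:p_vertex T r v:] * inverse_label (cls e)) - [:p_vertex T r v:]"
  proof -
    have "(\<Sum>e\<in>out_arcs T v. [:p_vertex T r (head T e):]) = [:p_vertex T r v:]"
      by (simp only: p_vertex_internal[OF assms] const_sum)
    moreover have "(\<Sum>e\<in>out_arcs T v. [:p_vertex T r (tail T e):] * inverse_label (cls e))
        = (\<Sum>e\<in>out_arcs T v. [:p_vertex T r v:] * inverse_label (cls e))"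
      by (rule sum.cong) auto
    ultimately show ?thesis
      by (simp only: sum_subtractf)
  qed
  also have "\<dots> = [:p_vertex T r v:] * ((\<Sum>e\<in>out_arcs T v. inverse_label (cls e)) - 1)"
    by (simp only: right_diff_distrib sum_distrib_left mult_1_right)
  finally show "[:p_vertex T r v:] * ((\<Sum>e\<in>out_arcs T v. inverse_label (cls e)) - 1) \<in> inv_ideal" .
  show "[:0, cofactor v:] * [:p_vertex T r v:] - 1 \<in> inv_ideal"
    using assms by (intro p_vertex_unit) (simp add: internals_def)
qed (simp_all del: mult_pCons_left mult_pCons_right)

lemma inverse_map_ideal:
  assumes "g \<in> sum_to_one_ideal T \<theta> stage" shows "inverse_map g \<in> inv_ideal"
proof -
  let ?K = "{g \<in> carrier (mpoly_ring (cls ` arcs T)). inverse_map g \<in> inv_ideal}"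
  have "mpoly_ideal ?K (cls ` arcs T)"
    by (rule mpoly_idealI)
      (auto simp: inverse_map_def const.poly_eval_add const.poly_eval_mult
        intro!: inv_ideal_add inv_ideal_mult poly_eval_polys)
  then have "sum_to_one_ideal T \<theta> stage \<subseteq> ?K"
    unfolding sum_to_one_ideal_def label_ring_def
  proof (intro mpoly_genideal_minimal subsetI)
    fix g assume "g \<in> {(\<Sum>e\<in>out_arcs T v. label e) - 1 | v. v \<in> verts T \<and> out_arcs T v \<noteq> {}}"
    then obtain v where "v \<in> verts T" "out_arcs T v \<noteq> {}" and g: "g = (\<Sum>e\<in>out_arcs T v. label e) - 1"
      by blast
    then have "(\<Sum>e\<in>out_arcs T v. inverse_label (cls e)) - 1 \<in> inv_ideal"
      by (intro inverse_label_sum)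
    then show "g \<in> ?K"
      using sum_labels_closed by (simp add: g inverse_map_def const.poly_eval_diff const.poly_eval_sum)
  qed
  then show ?thesis
    using assms by blast
qed

text \<open>The telescoping product. The factor \<open>p\<^sub>r\<close> is kept on the left because it is not invertible when
  the tree is a single vertex: then the product of denominators is empty.\<close>
lemma inverse_label_walk:
  assumes "v \<in> verts T"
  shows "[:p_vertex T r r:] * (\<Prod>e\<in>set (root_walk v). inverse_label (cls e)) - [:p_vertex T r v:]
    \<in> inv_ideal"
  using assms
proof (induction rule: vertex_induct)
  case root
  then show ?case by simp
next
  case (head e)
  let ?w = "\<Prod>f\<in>set (root_walk (tail T e)). inverse_label (cls f)"
  have "(\<Prod>f\<in>set (root_walk (head T e)). inverse_label (cls f)) = inverse_label (cls e) * ?w"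
    using head.hyps distinct_root_walk[of "head T e"] root_walk_head[of e] by auto
  moreover have "inverse_label (cls e) * ([:p_vertex T r r:] * ?w - [:p_vertex T r (tail T e):])
      + ([:p_vertex T r (tail T e):] * inverse_label (cls e) - [:p_vertex T r (head T e):]) \<in> inv_ideal"
    using head by (intro inv_ideal_add inv_ideal_mult inverse_label_cong) simp_all
  moreover have "a * (b * w) - h = b * (a * w - t) + (t * b - h)" for a b w h t :: "'e list rpoly poly"
    by (simp add: algebra_simps)
  ultimately show ?case
    by (simp only:)
qed

lemma inverse_map_label_subst:
  assumes "f \<in> carrier (mpoly_ring (paths T r))"
  shows "inverse_map (label_subst f) =
    poly_eval (\<lambda>a. [:mconst a:]) (\<lambda>es. \<Prod>e\<in>set es. inverse_label (cls e)) f"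
  unfolding inverse_map_def const.poly_eval_msubst[OF assms]
  by (simp add: const.poly_eval_prod)

lemma inverse_label_path:
  assumes "es \<in> paths T r"
  shows "[:p_vertex T r r:] * (\<Prod>e\<in>set es. inverse_label (cls e)) - [:mvar es:] \<in> inv_ideal"
proof -
  obtain l where "l \<in> verts T" "out_arcs T l = {}" "es = root_walk l"
    using assms by (auto simp: paths_eq_leaves)
  then show ?thesis
    using inverse_label_walk[of l] by (simp only: p_vertex_leaf)
qed

lemma inverse_map_homogeneous:
  assumes "f \<in> carrier (mpoly_ring (paths T r))" "homogeneous n f"
  shows "[:p_vertex T r r:] ^ n * inverse_map (label_subst f) - [:f:] \<in> inv_ideal"
proof -
  let ?\<tau> = "\<lambda>es. [:p_vertex T r r:] * (\<Prod>e\<in>set es. inverse_label (cls e))"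
  have "poly_eval (\<lambda>a. [:mconst a:]) ?\<tau> f - poly_eval (\<lambda>a. [:mconst a:]) (\<lambda>es. [:mvar es:]) f \<in> inv_ideal"
    using assms(1)
    by (rule poly_eval_cong_inv_ideal)
      (auto intro!: inverse_label_path polys_mult polys_prod simp del: mult_pCons_left mult_pCons_right)
  then show ?thesis
    using assms by (simp add: inverse_map_label_subst const.poly_eval_scale poly_eval_mvar_const
        del: mult_pCons_left mult_pCons_right)
qed

lemma inverse_map_affine:
  assumes "f \<in> carrier (mpoly_ring (paths T r))" "p_vertex T r r - 1 \<in> I"
  shows "inverse_map (label_subst f) - [:f:] \<in> inv_ideal"
proof -
  have "(\<Prod>e\<in>set es. inverse_label (cls e)) - [:mvar es:] \<in> inv_ideal" if "es \<in> paths T r" for es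
  proof -
    let ?w = "\<Prod>e\<in>set es. inverse_label (cls e)"
    have "?w * [:p_vertex T r r - 1:] \<in> inv_ideal"
      using assms(2) by (intro inv_ideal_mult inv_ideal_const) simp_all
    then have "?w * ([:p_vertex T r r:] - 1) \<in> inv_ideal"
      by (simp add: one_pCons)
    note diff = inv_ideal_diff[OF inverse_label_path[OF that] this]
    have "s * w - m - w * (s - 1) = w - m" for s w m :: "'e list rpoly poly"
      by (simp add: algebra_simps)
    then show ?thesis
      using diff by (simp only:)
  qed
  then have "poly_eval (\<lambda>a. [:mconst a:]) (\<lambda>es. \<Prod>e\<in>set es. inverse_label (cls e)) f
      - poly_eval (\<lambda>a. [:mconst a:]) (\<lambda>es. [:mvar es:]) f \<in> inv_ideal"
    by (intro poly_eval_cong_inv_ideal[OF assms(1)]) auto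
  then show ?thesis
    using assms(1) by (simp add: inverse_map_label_subst poly_eval_mvar_const)
qed

text \<open>Applying the inverse substitution to \<open>label_subst f \<equiv> 0\<close> shows that \<open>f\<close> vanishes once \<open>d\<close> is
  inverted. Homogeneity enters only through the single power of \<open>p\<^sub>r\<close> by which the inverse
  substitution fails to return \<open>f\<close>.\<close>
lemma homogeneous_kernel_torsion:
  assumes "f \<in> carrier (mpoly_ring (paths T r))" "homogeneous n f"
    and "label_subst f \<in> sum_to_one_ideal T \<theta> stage"
  shows "\<exists>m. denominators T r ^ m * f \<in> I"
proof -
  have "[:p_vertex T r r:] ^ n * inverse_map (label_subst f) \<in> inv_ideal"
  proof (rule inv_ideal_mult)
    show "[:p_vertex T r r:] ^ n \<in> polys"
      by (induction n) (simp_all del: mult_pCons_left mult_pCons_right)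
  qed (rule inverse_map_ideal[OF assms(3)])
  then have "[:f:] \<in> inv_ideal"
    using inv_ideal_diff[OF _ inverse_map_homogeneous[OF assms(1,2)]] by fastforce
  then show ?thesis
    by (rule inv_ideal_constD) blast
qed

lemma affine_kernel_torsion:
  assumes "f \<in> carrier (mpoly_ring (paths T r))" "p_vertex T r r - 1 \<in> I"
    and "label_subst f \<in> sum_to_one_ideal T \<theta> stage"
  shows "\<exists>m. denominators T r ^ m * f \<in> I"
proof -
  have "[:f:] \<in> inv_ideal"
    using inv_ideal_diff[OF inverse_map_ideal[OF assms(3)] inverse_map_affine[OF assms(1,2)]] by simp
  then show ?thesis
    by (rule inv_ideal_constD) blast
qed

end

section \<open>Localised kernels\<close>
context staged_tree
begin

lemma inverse_model_map_projective: "inverse_model_map T r \<theta> stage (invariant_ideal T r \<theta> stage)"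
  using invariant_ideal invariants_subset staged_tree_axioms
  by (simp add: inverse_model_map_def inverse_model_map_axioms_def inverting_def inverting_axioms_def)

lemma inverse_model_map_affine: "inverse_model_map T r \<theta> stage (affine_invariant_ideal T r \<theta> stage)"
  using affine_invariant_ideal affine_invariant_ideal_supset(1) invariants_subset staged_tree_axioms
  by (auto simp: inverse_model_map_def inverse_model_map_axioms_def inverting_def inverting_axioms_def)

lemma homogeneous_ker_ideal: "mpoly_ideal (homogeneous_ker T r \<theta> stage) (paths T r)"
  unfolding homogeneous_ker_def prob_ring_def
  by (rule mpoly_ideal_genideal) (auto simp: model_ker_eq)

text \<open>The homogeneous kernel is generated by elements with a multiple \<open>d\<^sup>n f\<close> in the ideal of
  invariants, and elements with this property form an ideal.\<close>
lemma loc_homogeneous_ker: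
  "loc_ideal (prob_ring T r) (denominators T r) (homogeneous_ker T r \<theta> stage) =
    loc_ideal (prob_ring T r) (denominators T r) (invariant_ideal T r \<theta> stage)"
proof -
  interpret P: localisation "prob_ring T r" "denominators T r"
    using cring_mpoly_ring[of "paths T r"]
    by (simp add: prob_ring_def localisation_def localisation_axioms_def)
  interpret M: inverse_model_map T r \<theta> stage "invariant_ideal T r \<theta> stage"
    by (rule inverse_model_map_projective)
  let ?d = "denominators T r"
  let ?S = "{f \<in> model_ker T r \<theta> stage. \<exists>d. homogeneous d f}"
  let ?K = "{f \<in> carrier (mpoly_ring (paths T r)). \<exists>n. ?d ^ n * f \<in> invariant_ideal T r \<theta> stage}"
  have S: "?S \<subseteq> carrier (mpoly_ring (paths T r))"
    by (auto simp: model_ker_eq)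
  show ?thesis
  proof (rule P.loc_ideal_eqI)
    have "invariants \<subseteq> ?S"
      using invariants_ker invariants_homogeneous by blast
    then have "invariants \<subseteq> homogeneous_ker T r \<theta> stage"
      using mpoly_genideal_self[OF S] unfolding homogeneous_ker_def prob_ring_def by blast
    then show "invariant_ideal T r \<theta> stage \<subseteq> homogeneous_ker T r \<theta> stage"
      unfolding invariant_ideal_eq by (rule mpoly_genideal_minimal[OF homogeneous_ker_ideal])
    show "homogeneous_ker T r \<theta> stage \<subseteq> carrier (prob_ring T r)"
      using mpoly_ideal.I_carrier[OF homogeneous_ker_ideal] by (auto simp: prob_ring_def)
    have "mpoly_ideal ?K (paths T r)"
    proof (rule mpoly_idealI)
      fix f g assume "f \<in> ?K" "g \<in> ?K"
      then obtain m n where fg: "f \<in> carrier (mpoly_ring (paths T r))" "g \<in> carrier (mpoly_ring (paths T r))"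
        and m: "?d ^ m * f \<in> invariant_ideal T r \<theta> stage" and n: "?d ^ n * g \<in> invariant_ideal T r \<theta> stage"
        by auto
      have "?d ^ n * (?d ^ m * f) + ?d ^ m * (?d ^ n * g) \<in> invariant_ideal T r \<theta> stage"
        using m n by (intro M.I_add[OF M.I_mult M.I_mult]) auto
      then have "?d ^ (m + n) * (f + g) \<in> invariant_ideal T r \<theta> stage"
        by (simp add: power_add algebra_simps)
      with fg show "f + g \<in> ?K"
        by auto
    next
      fix f g assume f: "f \<in> carrier (mpoly_ring (paths T r))" and "g \<in> ?K"
      then obtain n where g: "g \<in> carrier (mpoly_ring (paths T r))"
        and n: "?d ^ n * g \<in> invariant_ideal T r \<theta> stage"
        by auto
      have "?d ^ n * (f * g) \<in> invariant_ideal T r \<theta> stage"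
        using M.I_mult[OF f n] by (simp add: mult.left_commute)
      with f g show "f * g \<in> ?K"
        by auto
    qed auto
    then have "homogeneous_ker T r \<theta> stage \<subseteq> ?K"
      unfolding homogeneous_ker_def prob_ring_def
      by (rule mpoly_genideal_minimal) (auto simp: model_ker_eq dest: M.homogeneous_kernel_torsion)
    then show "\<exists>n::nat. ?d [^]\<^bsub>prob_ring T r\<^esub> n \<otimes>\<^bsub>prob_ring T r\<^esub> f \<in> invariant_ideal T r \<theta> stage"
      if "f \<in> homogeneous_ker T r \<theta> stage" for f
      using that by (auto simp: prob_ring_def)
  qed
qed

lemma loc_model_ker:
  "loc_ideal (prob_ring T r) (denominators T r) (model_ker T r \<theta> stage) =
    loc_ideal (prob_ring T r) (denominators T r) (affine_invariant_ideal T r \<theta> stage)"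
proof -
  interpret P: localisation "prob_ring T r" "denominators T r"
    using cring_mpoly_ring[of "paths T r"]
    by (simp add: prob_ring_def localisation_def localisation_axioms_def)
  interpret M: inverse_model_map T r \<theta> stage "affine_invariant_ideal T r \<theta> stage"
    by (rule inverse_model_map_affine)
  show ?thesis
    using affine_invariant_ideal_ker affine_invariant_ideal_supset(2)
    by (intro P.loc_ideal_eqI) (auto simp: model_ker_eq prob_ring_def dest: M.affine_kernel_torsion)
qed

sublocale L: inverting "sum_to_one_ideal T \<theta> stage" "cls ` arcs T" "label_subst (denominators T r)"
  by unfold_locales (simp add: label_subst_closed)

lemma loc_label_quot_eq: "loc_label_quot T r \<theta> stage =
    localise (mpoly_ring (cls ` arcs T) Quot sum_to_one_ideal T \<theta> stage)
      (sum_to_one_ideal T \<theta> stage +>\<^bsub>mpoly_ring (cls ` arcs T)\<^esub> label_subst (denominators T r))"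
  by (simp add: loc_label_quot_def label_quot_def label_ring_def model_map_eq)

lemma label_frac_eq:
  "label_frac T r \<theta> stage (sum_to_one_ideal T \<theta> stage +>\<^bsub>mpoly_ring (cls ` arcs T)\<^esub> g) k = L.frac g k"
  by (simp add: label_frac_def label_quot_def label_ring_def model_map_eq)

end

section \<open>The localised model map\<close>
context inverse_model_map
begin

lemma loc_prob_quot_eq: "loc_prob_quot T r I =
    localise (mpoly_ring (paths T r) Quot I) (I +>\<^bsub>mpoly_ring (paths T r)\<^esub> denominators T r)"
  by (simp add: loc_prob_quot_def prob_ring_def)

lemma prob_frac_eq: "prob_frac T r I f k = frac f k"
  by (simp add: prob_frac_def prob_ring_def)

context
  assumes I_ker: "I \<subseteq> model_ker T r \<theta> stage"
begin

lemma quot_model_map: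
  "f \<in> carrier (mpoly_ring (paths T r)) \<Longrightarrow>
    quot_map (model_map T \<theta> stage) (I +>\<^bsub>mpoly_ring (paths T r)\<^esub> f) = model_map T \<theta> stage f"
  "quot_map (model_map T \<theta> stage) \<in> ring_hom (mpoly_ring (paths T r) Quot I) (label_quot T \<theta> stage)"
proof -
  have ring: "ring (label_quot T \<theta> stage)"
    using label_quot_cring by (rule cring.axioms)
  have hom: "model_map T \<theta> stage \<in> ring_hom (mpoly_ring (paths T r)) (label_quot T \<theta> stage)"
    using model_map_hom by (simp add: prob_ring_def)
  have zero: "model_map T \<theta> stage f = \<zero>\<^bsub>label_quot T \<theta> stage\<^esub>" if "f \<in> I" for f
    using that I_ker by (auto simp: model_ker_def a_kernel_def')
  show "f \<in> carrier (mpoly_ring (paths T r)) \<Longrightarrow>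
      quot_map (model_map T \<theta> stage) (I +>\<^bsub>mpoly_ring (paths T r)\<^esub> f) = model_map T \<theta> stage f"
    by (rule quot_map_coset[OF ideal_axioms ring hom zero])
  show "quot_map (model_map T \<theta> stage) \<in> ring_hom (mpoly_ring (paths T r) Quot I) (label_quot T \<theta> stage)"
    by (rule quot_map_hom[OF ideal_axioms ring hom zero])
qed

lemma localised_hom_model_map:
  "localised_hom (mpoly_ring (paths T r) Quot I) (I +>\<^bsub>mpoly_ring (paths T r)\<^esub> denominators T r)
    (label_quot T \<theta> stage) (quot_map (model_map T \<theta> stage))"
  using localisation_quot label_quot_cring quot_model_map(2)
  by (simp add: localised_hom_def localised_hom_axioms_def)

lemma model_map_loc_frac:
  assumes "f \<in> carrier (mpoly_ring (paths T r))"
  shows "model_map_loc T r \<theta> stage (prob_frac T r I f k) = label_frac T r \<theta> stage (model_map T \<theta> stage f) k"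
proof -
  interpret H: localised_hom "mpoly_ring (paths T r) Quot I"
    "I +>\<^bsub>mpoly_ring (paths T r)\<^esub> denominators T r" "label_quot T \<theta> stage" "quot_map (model_map T \<theta> stage)"
    by (rule localised_hom_model_map)
  show ?thesis
    using H.loc_map_frac[OF quot_closed[OF assms] H.powersI, of k] assms
    by (simp add: prob_frac_eq model_map_loc_def label_frac_def quot_model_map(1) quot_closed)
qed

lemma model_map_loc_scalar:
  "model_map_loc T r \<theta> stage (prob_scalar T r I c) = label_scalar T r \<theta> stage c"
  by (simp add: prob_scalar_def label_scalar_def model_map_loc_frac model_map_eq label_subst_simps
      label_ring_def)

lemma model_map_loc_hom:
  "model_map_loc T r \<theta> stage \<in> ring_hom (loc_prob_quot T r I) (loc_label_quot T r \<theta> stage)"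
  using localised_hom.loc_map_hom[OF localised_hom_model_map]
  by (simp add: loc_prob_quot_eq loc_label_quot_def model_map_loc_def quot_model_map(1))

lemma model_map_loc_real_alg_hom:
  "model_map_loc T r \<theta> stage \<in> real_alg_hom (loc_prob_quot T r I) (prob_scalar T r I)
    (loc_label_quot T r \<theta> stage) (label_scalar T r \<theta> stage)"
  by (simp add: real_alg_hom_def model_map_loc_hom model_map_loc_scalar)

lemma model_map_loc_frac_label:
  "f \<in> carrier (mpoly_ring (paths T r)) \<Longrightarrow>
    model_map_loc T r \<theta> stage (frac f k) = L.frac (label_subst f) k"
  using model_map_loc_frac by (simp add: prob_frac_eq model_map_eq label_frac_eq)

text \<open>The kernel hypothesis is stated for the particular element that arises from the two fractions, so
  that it can be discharged by homogeneity in the projective case and by \<open>p\<^sub>r - 1\<close> in the affine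
  case.\<close>
lemma model_map_loc_frac_eqD:
  assumes "f \<in> carrier (mpoly_ring (paths T r))" "g \<in> carrier (mpoly_ring (paths T r))"
    and "model_map_loc T r \<theta> stage (frac f k) = model_map_loc T r \<theta> stage (frac g l)"
    and kernel: "\<And>m. label_subst (denominators T r ^ m * (denominators T r ^ l * f - denominators T r ^ k * g))
        \<in> sum_to_one_ideal T \<theta> stage \<Longrightarrow>
      \<exists>n. denominators T r ^ n * (denominators T r ^ m * (denominators T r ^ l * f - denominators T r ^ k * g)) \<in> I"
  shows "frac f k = frac g l"
proof -
  let ?d = "denominators T r"
  obtain m where "label_subst (?d ^ m * (?d ^ l * f - ?d ^ k * g)) \<in> sum_to_one_ideal T \<theta> stage"
    using assms(1-3) by (auto simp: model_map_loc_frac_label L.frac_eq_iff label_subst_closed label_subst_simps)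
  then obtain n where "?d ^ n * (?d ^ m * (?d ^ l * f - ?d ^ k * g)) \<in> I"
    using kernel by blast
  then have "?d ^ (n + m) * (?d ^ l * f - ?d ^ k * g) \<in> I"
    by (simp add: power_add mult.assoc)
  then show ?thesis
    using assms(1,2) frac_eq_iff by blast
qed

text \<open>A fraction \<open>g / \<phi>(d)\<^sup>l\<close> is the image of \<open>f p\<^sub>r\<^sup>n / d\<^sup>k\<^sup>+\<^sup>l\<close>, where \<open>f / d\<^sup>k\<close> is a preimage of \<open>g\<close> and
  \<open>n\<close> is the degree of \<open>d\<^sup>l\<close>; the factor \<open>p\<^sub>r\<^sup>n\<close> is invisible to the model map and restores
  degree zero.\<close>
lemma model_map_loc_surj:
  assumes "Y \<in> carrier (loc_label_quot T r \<theta> stage)"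
  obtains f k where "f \<in> carrier (mpoly_ring (paths T r))" "homogeneous (k * card internals) f"
    "Y = model_map_loc T r \<theta> stage (frac f k)"
proof -
  let ?J = "sum_to_one_ideal T \<theta> stage"
  let ?D = "label_subst (denominators T r)" and ?s = "p_vertex T r r"
  obtain g l where g: "g \<in> carrier (mpoly_ring (cls ` arcs T))" and Y: "Y = L.frac g l"
    using assms L.frac_cases by (auto simp: loc_label_quot_eq)
  obtain k f where f: "f \<in> carrier (mpoly_ring (paths T r))" "homogeneous (k * card internals) f"
    and fg: "label_subst f - ?D ^ k * g \<in> ?J"
    using label_fraction[OF g] by blast
  let ?n = "l * card internals"
  have s_power: "label_subst ?s ^ n - 1 \<in> ?J" for n
  proof (induction n)
    case (Suc n)
    then have "label_subst ?s * (label_subst ?s ^ n - 1) + (label_subst ?s - 1) \<in> ?J"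
      using label_subst_root by (intro L.I_add L.I_mult) (simp_all add: label_subst_closed)
    then show ?case
      by (simp add: algebra_simps)
  qed simp
  have "label_subst f * (label_subst ?s ^ ?n - 1) + (label_subst f - ?D ^ k * g) \<in> ?J"
    using s_power fg f(1) by (intro L.I_add L.I_mult) (simp_all add: label_subst_closed)
  then have "?D ^ l * (label_subst (f * ?s ^ ?n) - ?D ^ k * g) \<in> ?J"
    by (intro L.I_mult) (simp_all add: label_subst_simps label_subst_closed algebra_simps)
  then have "L.frac (label_subst (f * ?s ^ ?n)) (k + l) = L.frac g l"
    using f(1) g
    by (subst L.frac_eq_iff) (auto intro!: exI[of _ 0] simp: label_subst_closed power_add algebra_simps)
  then have "Y = model_map_loc T r \<theta> stage (frac (f * ?s ^ ?n) (k + l))"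
    using f(1) by (simp add: model_map_loc_frac_label Y)
  moreover have "homogeneous ((k + l) * card internals) (f * ?s ^ ?n)"
    using homogeneous_mult[OF f(2) homogeneous_power[OF homogeneous_p_vertex, of ?n]]
    by (simp add: algebra_simps)
  ultimately show ?thesis
    using f(1) by (intro that[of "f * ?s ^ ?n" "k + l"]) simp_all
qed

end

end

section \<open>The isomorphisms in projective and affine space\<close>
context staged_tree
begin

text \<open>For fractions of degree zero with the same image, the cross-multiplied difference of the
  numerators is homogeneous, so the homogeneous kernel suffices for injectivity.\<close>
lemma projective_iso:
  "model_map_loc T r \<theta> stage \<in> real_alg_iso
      (loc_prob_quot_degree0 T r (invariant_ideal T r \<theta> stage))
      (prob_scalar T r (invariant_ideal T r \<theta> stage))
      (loc_label_quot T r \<theta> stage) (label_scalar T r \<theta> stage)"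
proof -
  interpret M: inverse_model_map T r \<theta> stage "invariant_ideal T r \<theta> stage"
    by (rule inverse_model_map_projective)
  note ker = invariant_ideal_ker
  let ?d = "denominators T r" and ?h = "model_map_loc T r \<theta> stage"
  define C where "C = {M.frac f k | f k d. f \<in> carrier (mpoly_ring (paths T r)) \<and>
        homogeneous d f \<and> homogeneous d (denominators T r ^ k)}"
  have degree0: "loc_prob_quot_degree0 T r (invariant_ideal T r \<theta> stage) =
      (loc_prob_quot T r (invariant_ideal T r \<theta> stage))\<lparr>carrier := C\<rparr>"
    by (simp add: loc_prob_quot_degree0_def C_def M.prob_frac_eq prob_ring_def)
  note hom = M.model_map_loc_hom[OF ker]
  have C: "Y \<in> carrier (loc_prob_quot T r (invariant_ideal T r \<theta> stage))" if "Y \<in> C" for Y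
    using that M.frac_closed unfolding C_def M.loc_prob_quot_eq by blast
  have "?h \<in> ring_hom (loc_prob_quot_degree0 T r (invariant_ideal T r \<theta> stage))
      (loc_label_quot T r \<theta> stage)"
    unfolding degree0
    by (rule ring_hom_memI)
      (simp_all add: C ring_hom_closed[OF hom] ring_hom_mult[OF hom] ring_hom_add[OF hom] ring_hom_one[OF hom])
  moreover have "inj_on ?h C"
  proof (rule inj_onI)
    fix Y Z assume "Y \<in> C" "Z \<in> C" and eq: "?h Y = ?h Z"
    then obtain f k a g l b where Y: "Y = M.frac f k" and Z: "Z = M.frac g l"
      and f: "f \<in> carrier (mpoly_ring (paths T r))" "homogeneous a f" "homogeneous a (?d ^ k)"
      and g: "g \<in> carrier (mpoly_ring (paths T r))" "homogeneous b g" "homogeneous b (?d ^ l)"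
      unfolding C_def by blast
    have "homogeneous (a + b) (?d ^ l * f - ?d ^ k * g)"
      using homogeneous_mult[OF g(3) f(2)] homogeneous_mult[OF f(3) g(2)]
      by (intro homogeneous_diff) (simp_all add: add.commute)
    then have homog: "homogeneous (m * card internals + (a + b)) (?d ^ m * (?d ^ l * f - ?d ^ k * g))" for m
      by (rule homogeneous_mult[OF homogeneous_power[OF homogeneous_denominators]])
    show "Y = Z"
      unfolding Y Z
    proof (rule M.model_map_loc_frac_eqD[OF ker f(1) g(1)])
      fix m assume "label_subst (?d ^ m * (?d ^ l * f - ?d ^ k * g)) \<in> sum_to_one_ideal T \<theta> stage"
      then show "\<exists>n. ?d ^ n * (?d ^ m * (?d ^ l * f - ?d ^ k * g)) \<in> invariant_ideal T r \<theta> stage"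
        using f(1) g(1) by (intro M.homogeneous_kernel_torsion[OF _ homog]) simp_all
    qed (use eq Y Z in simp)
  qed
  moreover have "?h ` C = carrier (loc_label_quot T r \<theta> stage)"
  proof
    show "?h ` C \<subseteq> carrier (loc_label_quot T r \<theta> stage)"
      using C ring_hom_closed[OF hom] by blast
    show "carrier (loc_label_quot T r \<theta> stage) \<subseteq> ?h ` C"
    proof
      fix Y assume "Y \<in> carrier (loc_label_quot T r \<theta> stage)"
      then obtain f k where "f \<in> carrier (mpoly_ring (paths T r))" "homogeneous (k * card internals) f"
        "Y = ?h (M.frac f k)"
        by (rule M.model_map_loc_surj[OF ker])
      moreover from this have "M.frac f k \<in> C"
        using homogeneous_power[OF homogeneous_denominators, of k] unfolding C_def by blast
      ultimately show "Y \<in> ?h ` C"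
        by blast
    qed
  qed
  ultimately show ?thesis
    using M.model_map_loc_scalar[OF ker]
    by (simp add: real_alg_iso_def ring_iso_def bij_betw_def degree0)
qed

lemma affine_iso:
  "model_map_loc T r \<theta> stage \<in> real_alg_iso
      (loc_prob_quot T r (affine_invariant_ideal T r \<theta> stage))
      (prob_scalar T r (affine_invariant_ideal T r \<theta> stage))
      (loc_label_quot T r \<theta> stage) (label_scalar T r \<theta> stage)"
proof -
  interpret M: inverse_model_map T r \<theta> stage "affine_invariant_ideal T r \<theta> stage"
    by (rule inverse_model_map_affine)
  note ker = affine_invariant_ideal_ker
  let ?d = "denominators T r" and ?h = "model_map_loc T r \<theta> stage"
  let ?C = "carrier (loc_prob_quot T r (affine_invariant_ideal T r \<theta> stage))"
  have hom: "?h \<in> ring_hom (loc_prob_quot T r (affine_invariant_ideal T r \<theta> stage))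
      (loc_label_quot T r \<theta> stage)"
    by (rule M.model_map_loc_hom[OF ker])
  moreover have "inj_on ?h ?C"
  proof (rule inj_onI)
    fix Y Z assume "Y \<in> ?C" "Z \<in> ?C" and eq: "?h Y = ?h Z"
    then obtain f k g l where Y: "Y = M.frac f k" and Z: "Z = M.frac g l"
      and f: "f \<in> carrier (mpoly_ring (paths T r))" and g: "g \<in> carrier (mpoly_ring (paths T r))"
      unfolding M.loc_prob_quot_eq by (metis M.frac_cases)
    show "Y = Z"
      unfolding Y Z
    proof (rule M.model_map_loc_frac_eqD[OF ker f g])
      fix m assume "label_subst (?d ^ m * (?d ^ l * f - ?d ^ k * g)) \<in> sum_to_one_ideal T \<theta> stage"
      then show "\<exists>n. ?d ^ n * (?d ^ m * (?d ^ l * f - ?d ^ k * g)) \<in> affine_invariant_ideal T r \<theta> stage"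
        using f g affine_invariant_ideal_supset(2) by (intro M.affine_kernel_torsion) simp_all
    qed (use eq Y Z in simp)
  qed
  moreover have "?h ` ?C = carrier (loc_label_quot T r \<theta> stage)"
  proof
    show "?h ` ?C \<subseteq> carrier (loc_label_quot T r \<theta> stage)"
      using hom by (auto simp: ring_hom_def)
    show "carrier (loc_label_quot T r \<theta> stage) \<subseteq> ?h ` ?C"
      using M.frac_closed unfolding M.loc_prob_quot_eq
      by (blast elim: M.model_map_loc_surj[OF ker])
  qed
  ultimately show ?thesis
    using M.model_map_loc_scalar[OF ker]
    by (simp add: real_alg_iso_def ring_iso_def bij_betw_def)
qed

end

theorem proposition6:
  fixes T :: "('v, 'e) pre_digraph" and r :: 'v and \<theta> :: "'e \<Rightarrow> real" and stage :: "'v rel"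
  assumes "staged_tree T r \<theta> stage"
  shows
   "(\<forall>J\<in>{invariant_ideal T r \<theta> stage, affine_invariant_ideal T r \<theta> stage}.
      model_map_loc T r \<theta> stage \<in> real_alg_hom
        (loc_prob_quot T r J) (prob_scalar T r J)
        (loc_label_quot T r \<theta> stage) (label_scalar T r \<theta> stage) \<and>
      (\<forall>f\<in>carrier (prob_ring T r). \<forall>k.
        model_map_loc T r \<theta> stage (prob_frac T r J f k) =
          label_frac T r \<theta> stage (model_map T \<theta> stage f) k)) \<and>
    \<comment> \<open>in projective space\<close>
    model_map_loc T r \<theta> stage \<in> real_alg_iso
      (loc_prob_quot_degree0 T r (invariant_ideal T r \<theta> stage))
      (prob_scalar T r (invariant_ideal T r \<theta> stage))
      (loc_label_quot T r \<theta> stage) (label_scalar T r \<theta> stage) \<and>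
    loc_ideal (prob_ring T r) (denominators T r) (homogeneous_ker T r \<theta> stage) =
      loc_ideal (prob_ring T r) (denominators T r) (invariant_ideal T r \<theta> stage) \<and>
    \<comment> \<open>in affine space\<close>
    model_map_loc T r \<theta> stage \<in> real_alg_iso
      (loc_prob_quot T r (affine_invariant_ideal T r \<theta> stage))
      (prob_scalar T r (affine_invariant_ideal T r \<theta> stage))
      (loc_label_quot T r \<theta> stage) (label_scalar T r \<theta> stage) \<and>
    loc_ideal (prob_ring T r) (denominators T r) (model_ker T r \<theta> stage) =
      loc_ideal (prob_ring T r) (denominators T r) (affine_invariant_ideal T r \<theta> stage)"
proof -
  interpret staged_tree T r \<theta> stage by fact
  note proj = inverse_model_map_projective invariant_ideal_ker
    and aff = inverse_model_map_affine affine_invariant_ideal_ker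
  have "f \<in> carrier (mpoly_ring (paths T r))" if "f \<in> carrier (prob_ring T r)" for f
    using that by (simp add: prob_ring_def)
  then show ?thesis
    using inverse_model_map.model_map_loc_real_alg_hom[OF proj]
      inverse_model_map.model_map_loc_real_alg_hom[OF aff]
      inverse_model_map.model_map_loc_frac[OF proj] inverse_model_map.model_map_loc_frac[OF aff]
      projective_iso loc_homogeneous_ker affine_iso loc_model_ker
    by simp
qed

end
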